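(* For every nonnegative integer $p$, \begin{align*} &\sum_{\substack{0\le m\le p\\ m \text{ even}}}\ \sum_{\substack{\alpha_0+\alpha_1+\cdots+\alpha_{m+1}=p+3\\ \alpha_i\ge 1}} 2^{\alpha_{m+1}+1}\,\zeta(\alpha_0,\alpha_1,\ldots,\alpha_m,\alpha_{m+1}+1)\\ &\quad=\sum_{m=0}^{\lfloor p/2\rfloor} Z_-(2m)\,Z_+(p-2m)+Z_+(p+2)+\begin{cases}(p+2)\zeta(p+4)-Z_-(p+2), & p \text{ even},\\ (p-1)\zeta(p+4), & p\text{ odd}.\end{cases} \end{align*}
   Context: For positive integers $\alpha_1,\ldots,\alpha_r$ with $\alpha_r\ge 2$, the multiple zeta value is $\zeta(\alpha_1,\ldots,\alpha_r)=\sum_{1\le k_1<k_2<\cdots<k_r}k_1^{-\alpha_1}\cdots k_r^{-\alpha_r}$. The inner sum on the left runs over all $(m+2)$-tuples $(\alpha_0,\ldots,\alpha_{m+1})$ of positive integers with sum $p+3$. $\{1\}^a$ denotes $a$ repetitions of $1$. For a nonnegative integer $n$, $Z_-(n)=\sum_{a+b=n}(-1)^b\zeta(\{1\}^a,b+2)$ and $Z_+(n)=\sum_{a+b=n}\zeta(\{1\}^a,b+2)$, where the sums run over nonnegative integers $a,b$. *)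

theory Defs
  imports "HOL-Analysis.Analysis"
begin

definition mzv :: "nat list \<Rightarrow> real" where
  "mzv \<alpha>s = (\<Sum>\<^sub>\<infinity>ks \<in> {ks :: nat list. length ks = length \<alpha>s \<and> sorted_wrt (<) ks \<and> (\<forall>k\<in>set ks. 1 \<le> k)}.
     \<Prod>i<length \<alpha>s. 1 / real (ks ! i) ^ (\<alpha>s ! i))"

definition Z_minus :: "nat \<Rightarrow> real" where
  "Z_minus n = (\<Sum>(a, b) \<in> {(a, b). a + b = n}. (-1) ^ b * mzv (replicate a 1 @ [b + 2]))"

definition Z_plus :: "nat \<Rightarrow> real" where
  "Z_plus n = (\<Sum>(a, b) \<in> {(a, b). a + b = n}. mzv (replicate a 1 @ [b + 2]))"

definition compositions :: "nat \<Rightarrow> nat \<Rightarrow> nat list set" where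
  "compositions r n = {\<alpha>s. length \<alpha>s = r \<and> (\<forall>a\<in>set \<alpha>s. 1 \<le> a) \<and> sum_list \<alpha>s = n}"

end

theory Submission
  imports Defs "HOL-Real_Asymp.Real_Asymp"
begin

text \<open>
  Multiply both sides by a power of t and sum over p. For 0 < t < 1/2 put
  a(k) = \<Prod>_{j<k} j / (j - t) and c(k) = \<Prod>_{j<k} (j - 2t) / (j - t). The left-hand sides, with the
  term m = p + 1 added for odd p, have the generating function
  \<Sum>_k 2 (a(k) - c(k)) / (k (k - 2t)), while by Gauss' summation theorem
  1 - t^2 \<Sum>_n Z_+(n) t^n = \<Gamma>(1 - t)^2 / \<Gamma>(1 - 2t) and
  1 + t^2 \<Sum>_n Z_-(n) t^n = \<Gamma>(1 - t) \<Gamma>(1 + t).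
  The series \<Sum>_k c(k) / (k - 2t) is transported, by a telescoping argument with the connector
  a(n) c(k) / (n + k - 2t), into t \<Sum>_k a(k) / ((k - t) (k - 2t)) plus the product of these two Gamma
  factors divided by t. What remains is \<Sum>_k a(k) / (k (k - t)) = \<Sum>_k 1 / (k - t)^2 and
  t \<Sum>_k c(k) / k = 1 - t^2 \<Sum>_k 1 / (k^2 - t^2), which are two cases of one double telescoping, and
  comparing coefficients gives the theorem. The symmetry of Gauss' formula yields
  \<zeta>({1}^a, b + 2) = \<zeta>({1}^b, a + 2), hence Z_-(n) = 0 for odd n.
\<close>

section \<open>Telescoping series of Pochhammer quotients\<close>

text \<open>The factor \<open>2 ^ (... + 1)\<close> makes the sum over the last exponent a geometric
  series of ratio 2t/k; this is where k - 2t and the bound t < 1/2 come from. Marking each of the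
  other exponents by a sign \<epsilon>, the sum over all their lists with indices below k is the
  product over j < k of 1 + \<epsilon> t / (j - t). This is a(k) for \<epsilon> = 1 and c(k) for
  \<epsilon> = -1, and half the difference keeps the lists of odd length m + 1. No bound on m
  survives this, hence the additional term m = p + 1. The obstacle is the c-series with denominator
  k - 2t. By 2t / (k (k - 2t)) = 1 / (k - 2t) - 1 / k it is split off, and t / ((k - t) (k - 2t)) =
  1 / (k - 2t) - 1 / (k - t) shows that its transported form cancels exactly the part of the
  a-series with the same denominator. Only the denominators k and k - t remain. The code counts by i
  = k - 1, so a(k) is \<open>fact i / pochhammer (1 - t) i\<close> and c(k) is
  \<open>pochhammer (1 - 2 * t) i / pochhammer (1 - t) i\<close>.\<close>

lemma pochhammer_ratio_sums:
  fixes a b :: real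
  assumes "0 < a" "a < b"
  shows pochhammer_ratio_tendsto_0: "(\<lambda>n. pochhammer a n / pochhammer b n) \<longlonglongrightarrow> 0"
    and pochhammer_ratio_div_sums:
      "(\<lambda>n. pochhammer a n / pochhammer b n / (b + real n)) sums (1 / (b - a))"
proof -
  define r where "r n = pochhammer a n / pochhammer b n" for n
  have pos: "r n > 0" for n
    using assms by (auto simp: r_def intro!: divide_pos_pos pochhammer_pos)
  have step: "r n - r (Suc n) = (b - a) * (r n / (b + real n))" for n
  proof -
    have "pochhammer b n > 0"
      using assms by (intro pochhammer_pos) auto
    moreover have "b + real n > 0" using assms by simp
    ultimately show ?thesis
      unfolding r_def pochhammer_Suc by (simp add: divide_simps) (simp add: algebra_simps)
  qed
  have "decseq r"
  proof (rule decseq_SucI)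
    fix n
    have "(b - a) * (r n / (b + real n)) \<ge> 0"
      using assms pos[of n] by auto
    thus "r (Suc n) \<le> r n" using step[of n] by linarith
  qed
  then obtain L where L: "r \<longlonglongrightarrow> L" "\<And>i. L \<le> r i"
    using decseq_convergent[of r 0] pos less_imp_le by blast
  have sums: "(\<lambda>n. (b - a) * (r n / (b + real n))) sums (r 0 - L)"
    using telescope_sums'[OF L(1)] by (simp add: step)
  \<comment> \<open>If \<open>r\<close> stayed above a positive \<open>L\<close>, the convergent
    telescoped series would dominate a multiple of the harmonic series, since
    \<open>b + n \<le> (b + 1) * (n + 1)\<close>.\<close>
  have "L = 0"
  proof (rule ccontr)
    assume "L \<noteq> 0"
    moreover have "L \<ge> 0"
      using L(1) pos by (intro LIMSEQ_le_const[OF L(1)]) (auto intro!: exI[of _ 0] less_imp_le)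
    ultimately have "L > 0" by simp
    have "summable (\<lambda>n. r n / (b + real n))"
      using sums_summable[OF sums_divide[OF sums, of "b - a"]] assms by simp
    hence "summable (\<lambda>n. (b + 1) / L * (r n / (b + real n)))"
      by (intro summable_mult)
    hence "summable (\<lambda>n. 1 / real (Suc n))"
    proof (rule summable_comparison_test'[where N = 0], goal_cases)
      case (1 n)
      have "b + real n \<le> (b + 1) * real (Suc n)"
        using assms by (simp add: algebra_simps)
      hence "1 / real (Suc n) \<le> (b + 1) / (b + real n)"
        using assms by (simp add: field_simps)
      also have "\<dots> = (b + 1) / (b + real n) * 1" by simp
      also have "\<dots> \<le> (b + 1) / (b + real n) * (r n / L)"
        using assms L(2)[of n] \<open>L > 0\<close> by (intro mult_left_mono) auto
      also have "\<dots> = (b + 1) / L * (r n / (b + real n))" by simp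
      finally show ?case by simp
    qed
    hence "summable (\<lambda>n. inverse (real n))"
      using summable_Suc_iff[of "\<lambda>n. inverse (real n)"] by (simp add: inverse_eq_divide)
    thus False using not_summable_harmonic[where 'a=real] by simp
  qed
  show "(\<lambda>n. pochhammer a n / pochhammer b n) \<longlonglongrightarrow> 0"
    using L(1) \<open>L = 0\<close> by (simp add: r_def[abs_def])
  show "(\<lambda>n. pochhammer a n / pochhammer b n / (b + real n)) sums (1 / (b - a))"
    using sums_divide[OF sums, of "b - a"] assms \<open>L = 0\<close> by (simp add: r_def)
qed

lemma summable_pochhammer_ratio_div:
  fixes a b c :: real
  assumes "0 < a" "a < b" "0 < c"
  shows "summable (\<lambda>n. pochhammer a n / pochhammer b n / (c + real n))"
proof (rule summable_comparison_test')
  show "summable (\<lambda>n. (b / c + 1) * (pochhammer a n / pochhammer b n / (b + real n)))"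
    using pochhammer_ratio_div_sums[OF assms(1,2)] by (intro summable_mult) (auto simp: sums_iff)
  fix n :: nat
  have p: "pochhammer a n > 0" "pochhammer b n > 0"
    using assms by (auto intro!: pochhammer_pos)
  hence r: "pochhammer a n / pochhammer b n \<ge> 0"
    by simp
  have "b + real n \<le> (b / c + 1) * (c + real n)"
    using assms by (simp add: field_simps)
  hence "1 / (c + real n) \<le> (b / c + 1) / (b + real n)"
    using assms by (simp add: divide_simps mult_ac split: if_splits) (simp add: algebra_simps)?
  from mult_left_mono[OF this r]
  show "norm (pochhammer a n / pochhammer b n / (c + real n))
          \<le> (b / c + 1) * (pochhammer a n / pochhammer b n / (b + real n))"
    using p assms by (simp add: abs_mult mult_ac)
qed

text \<open>
  Replacing \<beta> by \<beta> + n in the series and summing the consecutive differences over n telescopes;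
  each difference is itself a telescoping series in i with value 1 / ((\<beta> + n - \<alpha>) (\<beta> + n)).
\<close>

lemma pochhammer_double_telescope:
  fixes \<alpha> \<beta> :: real
  assumes "-1 < \<alpha>" "\<alpha> < \<beta>" "\<beta> \<noteq> 0"
  shows "summable (\<lambda>i. pochhammer (\<alpha> + 1) i / (real (Suc i) * pochhammer \<beta> (Suc i)))"
    and "(\<lambda>n. 1 / ((\<beta> + real n - \<alpha>) * (\<beta> + real n))) sums
           (\<Sum>i. pochhammer (\<alpha> + 1) i / (real (Suc i) * pochhammer \<beta> (Suc i)))"
proof -
  define \<phi> where "\<phi> n i = pochhammer (\<alpha> + 1) i / (real (Suc i) * pochhammer (\<beta> + real n) (Suc i))"
    for n i
  define g where "g i = pochhammer (\<alpha> + 1) i / pochhammer (\<beta> + 1) i / (1 + real i)" for i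
  have g: "summable g"
    unfolding g_def using assms by (intro summable_pochhammer_ratio_div) auto
  \<comment> \<open>\<open>\<beta>\<close> may lie in (-1, 0), and the later choice
    \<open>\<beta> = - t\<close> does. Hence the first factor \<open>\<beta> + n\<close> of the
    Pochhammer symbol is kept apart under an absolute value; the remaining factors are
    positive.\<close>
  have bn0: "\<beta> + real n \<noteq> 0" for n
    using assms by (cases n) auto
  have \<phi>_bound: "norm (\<phi> n i) \<le> g i / \<bar>\<beta> + real n\<bar>" for n i
  proof -
    have *: "pochhammer (\<beta> + 1) i > 0"
      using assms by (intro pochhammer_pos) auto
    have **: "pochhammer (\<beta> + 1) i \<le> pochhammer (\<beta> + real n + 1) i"
      unfolding pochhammer_prod using assms by (intro prod_mono) auto
    have "pochhammer (\<alpha> + 1) i \<ge> 0"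
      using assms by (intro pochhammer_nonneg) auto
    have "norm (\<phi> n i) = pochhammer (\<alpha> + 1) i / real (Suc i) / \<bar>\<beta> + real n\<bar> / pochhammer (\<beta> + real n + 1) i"
      unfolding \<phi>_def pochhammer_rec using \<open>pochhammer (\<alpha> + 1) i \<ge> 0\<close> * **
      by (simp add: abs_mult)
    also have "\<dots> \<le> pochhammer (\<alpha> + 1) i / real (Suc i) / \<bar>\<beta> + real n\<bar> / pochhammer (\<beta> + 1) i"
      using * ** \<open>pochhammer (\<alpha> + 1) i \<ge> 0\<close> by (intro divide_left_mono) auto
    also have "\<dots> = g i / \<bar>\<beta> + real n\<bar>"
      by (simp add: g_def mult_ac)
    finally show ?thesis .
  qed
  have summ: "summable (\<phi> n)" for n
    using summable_comparison_test'[OF summable_divide[OF g, of "\<bar>\<beta> + real n\<bar>"] \<phi>_bound] by blast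
  define \<Phi> where "\<Phi> n = suminf (\<phi> n)" for n
  have "norm (\<Phi> n) \<le> norm (suminf g / (\<beta> + real n))" for n
  proof -
    have "norm (\<Phi> n) \<le> (\<Sum>i. g i / \<bar>\<beta> + real n\<bar>)"
      unfolding \<Phi>_def by (rule norm_suminf_le[OF \<phi>_bound summable_divide[OF g]])
    also have "\<dots> = suminf g / \<bar>\<beta> + real n\<bar>" by (rule suminf_divide[OF g])
    also have "\<dots> \<le> norm (suminf g / (\<beta> + real n))" by (simp add: divide_right_mono)
    finally show ?thesis .
  qed
  moreover have "(\<lambda>n. C / (\<beta> + real n)) \<longlonglongrightarrow> 0" for C
    by real_asymp
  hence "(\<lambda>n. norm (suminf g / (\<beta> + real n))) \<longlonglongrightarrow> 0"
    by (rule tendsto_norm_zero)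
  ultimately have lim: "\<Phi> \<longlonglongrightarrow> 0"
    by (rule Lim_null_comparison[OF always_eventually[OF allI]])
  have diff: "\<Phi> n - \<Phi> (Suc n) = 1 / ((\<beta> + real n - \<alpha>) * (\<beta> + real n))" for n
  proof -
    have 1: "(\<lambda>i. \<phi> n i - \<phi> (Suc n) i) sums (\<Phi> n - \<Phi> (Suc n))"
      unfolding \<Phi>_def by (intro sums_diff summable_sums summ)
    define z where "z = \<beta> + real n"
    have z: "z \<noteq> 0" "z > -1" "z > \<alpha>" using assms bn0[of n] by (auto simp: z_def)
    have eq: "\<phi> n i - \<phi> (Suc n) i =
            pochhammer (\<alpha> + 1) i / pochhammer (z + 1) i / (z + 1 + real i) / z" for i
    proof -
      have p: "pochhammer (z + 1) i > 0"
        using z by (intro pochhammer_pos) auto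
      have "\<phi> n i = pochhammer (\<alpha> + 1) i / (real (Suc i) * (z * pochhammer (z + 1) i))"
        by (simp add: \<phi>_def z_def pochhammer_rec)
      hence 1: "\<phi> n i = pochhammer (\<alpha> + 1) i / pochhammer (z + 1) i * (1 / (real (Suc i) * z))"
        by (simp add: mult_ac)
      have "\<phi> (Suc n) i = pochhammer (\<alpha> + 1) i / (real (Suc i) * (pochhammer (z + 1) i * (z + 1 + real i)))"
        unfolding \<phi>_def z_def by (simp add: pochhammer_Suc add_ac)
      hence 2: "\<phi> (Suc n) i = pochhammer (\<alpha> + 1) i / pochhammer (z + 1) i * (1 / (real (Suc i) * (z + real (Suc i))))"
        by (simp add: add_ac mult_ac)
      have 3: "1 / (real (Suc i) * z) - 1 / (real (Suc i) * (z + real (Suc i))) = 1 / (z * (z + real (Suc i)))"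
        using z by (simp add: divide_simps) (simp add: algebra_simps)?
      show ?thesis
        unfolding 1 2 right_diff_distrib[symmetric] 3 by (simp add: add_ac mult_ac)
    qed
    have "(\<lambda>i. \<phi> n i - \<phi> (Suc n) i) sums (1 / ((z + 1) - (\<alpha> + 1)) / z)"
      unfolding eq using z assms by (intro sums_divide pochhammer_ratio_div_sums) auto
    with 1 show ?thesis
      by (simp add: sums_iff z_def)
  qed
  have "(\<lambda>n. \<Phi> n - \<Phi> (Suc n)) sums (\<Phi> 0 - 0)"
    by (rule telescope_sums'[OF lim])
  thus "(\<lambda>n. 1 / ((\<beta> + real n - \<alpha>) * (\<beta> + real n))) sums
           (\<Sum>i. pochhammer (\<alpha> + 1) i / (real (Suc i) * pochhammer \<beta> (Suc i)))"
    unfolding diff by (simp add: \<Phi>_def \<phi>_def[abs_def])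
  show "summable (\<lambda>i. pochhammer (\<alpha> + 1) i / (real (Suc i) * pochhammer \<beta> (Suc i)))"
    using summ[of 0] by (simp add: \<phi>_def[abs_def])
qed

section \<open>Gauss' summation formula as a value of the Beta function\<close>

text \<open>\<open>N * gauss_sum x N\<close> is the hypergeometric value F(x, N; N + 1; 1), because
  (N)_k / (N + 1)_k = N / (N + k).\<close>

definition gauss_sum :: "real \<Rightarrow> real \<Rightarrow> real" where
  "gauss_sum x N = (\<Sum>k. pochhammer x k / fact k / (real k + N))"

lemma summable_gauss_sum:
  assumes "0 < x" "x < 1" "-1 < N" "N \<noteq> 0"
  shows "summable (\<lambda>k. pochhammer x k / fact k / (real k + N))"
proof (rule summable_comparison_test')
  \<comment> \<open>For negative \<open>N\<close> the term k = 0 has a negative denominator, so the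
    comparison starts at k = 1. There the ratio (1 + k) / (k + N) takes its largest value 2 / (1 +
    N).\<close>
  define C where "C = (if N > 0 then 1 / N + 1 else 2 / (1 + N))"
  show "summable (\<lambda>k. C * (pochhammer x k / fact k / (1 + real k)))"
    using pochhammer_ratio_div_sums[OF assms(1,2)]
    by (intro summable_mult) (auto simp: sums_iff pochhammer_fact)
  fix k :: nat assume k: "k \<ge> 1"
  have w0: "pochhammer x k \<ge> 0"
    using assms by (intro pochhammer_nonneg) auto
  hence w: "pochhammer x k / fact k \<ge> 0"
    by simp
  have pos: "real k + N > 0" using k assms by linarith
  have "1 + real k \<le> C * (real k + N)" if "N > 0"
    using that assms by (simp add: C_def field_simps)
  moreover have "1 + real k \<le> C * (real k + N)" if "N < 0"
  proof -
    have "(real k - 1) * (1 - N) \<ge> 0"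
      using k that by (intro mult_nonneg_nonneg) auto
    thus ?thesis using that assms by (simp add: C_def field_simps)
  qed
  ultimately have "1 + real k \<le> C * (real k + N)" using assms by linarith
  hence "1 / (real k + N) \<le> C / (1 + real k)"
    using pos by (simp add: field_simps)
  from mult_left_mono[OF this w]
  show "norm (pochhammer x k / fact k / (real k + N)) \<le> C * (pochhammer x k / fact k / (1 + real k))"
    using w0 pos by (simp add: mult_ac)
qed

lemma pochhammer_div_fact_tendsto_0:
  fixes x :: real
  assumes "0 < x" "x < 1"
  shows "(\<lambda>k. pochhammer x k / fact k) \<longlonglongrightarrow> 0"
  using pochhammer_ratio_tendsto_0[OF assms] by (simp add: pochhammer_fact)

lemma gauss_sum_pos:
  assumes "0 < x" "x < 1" "0 < N"
  shows "0 < gauss_sum x N"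
proof -
  have "pochhammer x k / fact k / (real k + N) > 0" for k
    using assms by (intro divide_pos_pos pochhammer_pos add_nonneg_pos) auto
  thus ?thesis
    unfolding gauss_sum_def using assms by (intro suminf_pos summable_gauss_sum) auto
qed

text \<open>\<open>V\<close> is a telescoping certificate: (k + 1) w(k + 1) = (x + k) w(k) turns
  \<open>V (Suc k) - V k\<close> into the difference of the two summands. \<open>V 0 = 0\<close>,
  and \<open>V\<close> tends to 0 because \<open>w\<close> does. Allowing N in (-1, 0) makes the
  step from \<open>- y\<close> to \<open>1 - y\<close> available later.\<close>

lemma gauss_sum_recurrence:
  assumes "0 < x" "x < 1" "-1 < N" "N \<noteq> 0"
  shows "N * gauss_sum x N = (N + 1 - x) * gauss_sum x (N + 1)"
proof -
  define w where "w k = pochhammer x k / fact k" for k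
  define V where "V k = real k * w k / (real k + N)" for k
  have w0: "w \<longlonglongrightarrow> 0"
    unfolding w_def using assms by (intro pochhammer_div_fact_tendsto_0)
  have "(\<lambda>k. real k / (real k + N)) \<longlonglongrightarrow> 1"
    by real_asymp
  from tendsto_mult[OF this w0] have V: "V \<longlonglongrightarrow> 0"
    by (simp add: V_def[abs_def] mult_ac)
  have kN: "real k + N \<noteq> 0" "real k + N + 1 \<noteq> 0" for k
    using assms by (cases k; simp)+
  have step: "V (Suc k) - V k = N * (w k / (real k + N)) - (N + 1 - x) * (w k / (real k + (N + 1)))" for k
  proof -
    have "V (Suc k) = (x + real k) * w k / (real k + N + 1)"
      by (simp add: V_def w_def pochhammer_Suc add_ac)
    moreover have "V k = w k - N * (w k / (real k + N))"
      using kN[of k] by (simp add: V_def field_simps)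
    moreover have "(x + real k) * w k / (real k + N + 1) = w k - (N + 1 - x) * (w k / (real k + N + 1))"
      using kN[of k] by (simp add: field_simps)
    ultimately show ?thesis by (simp add: add_ac)
  qed
  have "(\<lambda>k. N * (w k / (real k + N)) - (N + 1 - x) * (w k / (real k + (N + 1)))) sums
          (N * gauss_sum x N - (N + 1 - x) * gauss_sum x (N + 1))"
    unfolding gauss_sum_def w_def using assms
    by (intro sums_diff sums_mult summable_sums summable_gauss_sum) auto
  moreover have "(\<lambda>k. V (Suc k) - V k) sums (0 - V 0)"
    by (rule telescope_sums[OF V])
  ultimately show ?thesis
    unfolding step by (simp add: sums_iff V_def)
qed

lemma gauss_sum_shift:
  assumes "0 < x" "x < 1" "0 < N"
  shows "gauss_sum x N * pochhammer N n = pochhammer (N + 1 - x) n * gauss_sum x (N + real n)"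
proof (induction n)
  case (Suc n)
  have "gauss_sum x N * pochhammer N (Suc n) = pochhammer (N + 1 - x) n * ((N + real n) * gauss_sum x (N + real n))"
    using Suc by (simp add: pochhammer_Suc)
  also have "\<dots> = pochhammer (N + 1 - x) n * ((N + real n + 1 - x) * gauss_sum x (N + real n + 1))"
    by (subst gauss_sum_recurrence) (use assms in auto)
  finally show ?case by (simp add: pochhammer_Suc algebra_simps)
qed auto

lemma gauss_sum_1:
  assumes "0 < x" "x < 1"
  shows "gauss_sum x 1 = 1 / (1 - x)"
  using pochhammer_ratio_div_sums[OF assms, folded pochhammer_fact]
  unfolding gauss_sum_def by (simp only: sums_iff add.commute[of 1])

text \<open>With m = M + n and l = N + n, corresponding terms differ by the factor (l - m) / (k + m)
  relative to the term for l. Hence the relative error of the sums is at most |N - M| / (M +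
  n).\<close>

lemma gauss_sum_quotient_tendsto_1:
  assumes x: "0 < x" "x < 1" and "0 < M" "0 < N"
  shows "(\<lambda>n. gauss_sum x (M + real n) / gauss_sum x (N + real n)) \<longlonglongrightarrow> 1"
proof -
  have bound: "\<bar>gauss_sum x (M + real n) / gauss_sum x (N + real n) - 1\<bar> \<le> \<bar>N - M\<bar> / (M + real n)" for n
  proof -
    define w where "w k = pochhammer x k / fact k" for k
    have w: "w k \<ge> 0" for k
      unfolding w_def using assms by (intro divide_nonneg_pos pochhammer_nonneg) auto
    define m where "m = M + real n"
    define l where "l = N + real n"
    have pos: "m > 0" "l > 0" using assms by (auto simp: m_def l_def)
    have s: "summable (\<lambda>k. w k / (real k + m))" "summable (\<lambda>k. w k / (real k + l))"
      unfolding w_def using x pos by (intro summable_gauss_sum; simp)+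
    have "\<bar>gauss_sum x m - gauss_sum x l\<bar> = norm (\<Sum>k. w k / (real k + m) - w k / (real k + l))"
      using s by (simp add: gauss_sum_def w_def suminf_diff)
    also have "\<dots> \<le> (\<Sum>k. \<bar>l - m\<bar> / m * (w k / (real k + l)))"
    proof (intro norm_suminf_le summable_mult s)
      fix k
      have "w k / (real k + m) - w k / (real k + l) = (l - m) / (real k + m) * (w k / (real k + l))"
        using pos by (simp add: divide_simps) (simp add: algebra_simps)?
      hence "norm (w k / (real k + m) - w k / (real k + l)) = \<bar>l - m\<bar> / (real k + m) * (w k / (real k + l))"
        using pos w[of k] by (simp add: abs_mult)
      also have "\<dots> \<le> \<bar>l - m\<bar> / m * (w k / (real k + l))"
        using pos w[of k] by (intro mult_right_mono divide_left_mono) auto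
      finally show "norm (w k / (real k + m) - w k / (real k + l)) \<le> \<bar>l - m\<bar> / m * (w k / (real k + l))" .
    qed
    also have "\<dots> = \<bar>l - m\<bar> / m * gauss_sum x l"
      unfolding gauss_sum_def w_def by (rule suminf_mult[OF s(2)[unfolded w_def]])
    finally have *: "\<bar>gauss_sum x m - gauss_sum x l\<bar> \<le> \<bar>l - m\<bar> / m * gauss_sum x l" .
    have g: "gauss_sum x l > 0" using x pos by (intro gauss_sum_pos)
    have "\<bar>gauss_sum x m / gauss_sum x l - 1\<bar> = \<bar>gauss_sum x m - gauss_sum x l\<bar> / gauss_sum x l"
      using g by (simp add: divide_simps)
    also have "\<dots> \<le> \<bar>l - m\<bar> / m"
      using * g by (simp add: divide_le_eq)
    finally show ?thesis by (simp add: m_def l_def)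
  qed
  have "(\<lambda>n. C / (M + real n)) \<longlonglongrightarrow> 0" for C
    by real_asymp
  hence "(\<lambda>n. \<bar>N - M\<bar> / (M + real n)) \<longlonglongrightarrow> 0" .
  hence "(\<lambda>n. gauss_sum x (M + real n) / gauss_sum x (N + real n) - 1) \<longlonglongrightarrow> 0"
    by (rule Lim_null_comparison[rotated]) (use bound in \<open>auto intro!: always_eventually\<close>)
  thus ?thesis by (rule LIM_zero_cancel)
qed

text \<open>
  This is Gauss' summation theorem for F(x, N; N + 1; 1): the recurrence in N moves N to
  infinity, where the sum is compared with the telescoping case N = 1.
\<close>

lemma gauss_sum_eq_Beta:
  assumes x: "0 < x" "x < 1" and N: "0 < N"
  shows "gauss_sum x N = Beta N (1 - x)"
proof -
  \<comment> \<open>\<open>K n\<close> is the factor from shifting \<open>N\<close> by n, times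
    \<open>gauss_sum x (1 + n)\<close>, which is explicit since
    \<open>gauss_sum x 1 = 1 / (1 - x)\<close>. It is also a quotient of three
    \<open>Gamma_series\<close>, up to a rational factor tending to 1.\<close>
  define K where "K n = pochhammer (N + 1 - x) n * fact n / (pochhammer N n * pochhammer (1 - x) (Suc n))" for n
  have eq: "gauss_sum x N / K n = gauss_sum x (N + real n) / gauss_sum x (1 + real n)" for n
  proof -
    have p: "pochhammer N n > 0" "pochhammer (N + 1 - x) n > 0" "pochhammer (2 - x) n > 0" "1 - x > 0"
      using assms by (auto intro!: pochhammer_pos)
    have "gauss_sum x N = pochhammer (N + 1 - x) n * gauss_sum x (N + real n) / pochhammer N n"
      using gauss_sum_shift[OF assms, of n] p by (simp add: field_simps)
    moreover have "fact n / (1 - x) = pochhammer (2 - x) n * gauss_sum x (1 + real n)"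
      using gauss_sum_shift[OF x, of 1 n] x by (simp add: gauss_sum_1 flip: pochhammer_fact)
    hence "gauss_sum x (1 + real n) = fact n / ((1 - x) * pochhammer (2 - x) n)"
      using p by (simp add: field_simps)
    ultimately show ?thesis
      using p by (simp add: K_def pochhammer_rec[of "1 - x"])
  qed
  have "(\<lambda>n. Gamma_series N n * Gamma_series (1 - x) n / Gamma_series (N + 1 - x) n *
             ((N + real n) / (N + 1 - x + real n))) \<longlonglongrightarrow> 
        Gamma N * Gamma (1 - x) / Gamma (N + 1 - x) * 1"
  proof (intro tendsto_intros)
    show "Gamma (N + 1 - x) \<noteq> 0"
      using Gamma_real_pos[of "N + 1 - x"] assms by linarith
    show "(\<lambda>n. (N + real n) / (N + 1 - x + real n)) \<longlonglongrightarrow> 1"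
      by real_asymp
  qed
  moreover have "Gamma_series N n * Gamma_series (1 - x) n / Gamma_series (N + 1 - x) n *
             ((N + real n) / (N + 1 - x + real n)) = K n" for n
  proof -
    have p: "pochhammer N n > 0" "pochhammer (N + 1 - x) n > 0" "pochhammer (1 - x) n > 0"
            "N + real n > 0" "N + 1 - x + real n > 0" "1 - x + real n > 0"
      using assms by (auto intro!: pochhammer_pos)
    have "exp ((N + 1 - x) * ln (real n)) = exp (N * ln (real n)) * exp ((1 - x) * ln (real n))"
      by (simp add: algebra_simps flip: exp_add)
    thus ?thesis
      using p by (simp add: Gamma_series_def K_def pochhammer_Suc)
  qed
  ultimately have K: "K \<longlonglongrightarrow> Beta N (1 - x)"
    by (simp add: Beta_def add_diff_eq)
  have B: "Beta N (1 - x) > 0"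
    using assms by (auto simp: Beta_def intro!: divide_pos_pos mult_pos_pos Gamma_real_pos)
  have "(\<lambda>n. gauss_sum x N / K n) \<longlonglongrightarrow> gauss_sum x N / Beta N (1 - x)"
    using K B by (intro tendsto_intros) auto
  moreover have "(\<lambda>n. gauss_sum x N / K n) \<longlonglongrightarrow> 1"
    unfolding eq using assms by (intro gauss_sum_quotient_tendsto_1) auto
  ultimately have "gauss_sum x N / Beta N (1 - x) = 1"
    using LIMSEQ_unique by blast
  thus ?thesis using B by simp
qed

section \<open>Transport of the c-series into an a-series\<close>

text \<open>This is the regularity half of the Silverman-Toeplitz theorem for nonnegative matrices
  with infinite rows: since every column vanishes in the limit, the mass of a row moves to large i,
  where \<open>e i\<close> is close to \<open>L\<close>. It evaluates the limit of the connected
  sum, whose terms cannot be bounded uniformly by one summable sequence in an obvious way.\<close>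

lemma toeplitz_tendsto:
  fixes M :: "nat \<Rightarrow> nat \<Rightarrow> real"
  assumes M_nonneg: "\<And>n i. M n i \<ge> 0" and M: "\<And>n. M n sums S n" and S: "S \<longlonglongrightarrow> \<sigma>"
    and cols: "\<And>i. (\<lambda>n. M n i) \<longlonglongrightarrow> 0" and e: "e \<longlonglongrightarrow> L"
  shows "(\<lambda>n. \<Sum>i. e i * M n i) \<longlonglongrightarrow> L * \<sigma>"
proof -
  have "Bseq (\<lambda>i. e i - L)"
    using e by (intro convergent_imp_Bseq convergentI[of _ 0]) (simp add: LIM_zero)
  then obtain C where C: "C > 0" "\<And>i. \<bar>e i - L\<bar> \<le> C"
    by (auto simp: Bseq_def)
  have summ: "summable (\<lambda>i. (e i - L) * M n i)" "summable (\<lambda>i. \<bar>e i - L\<bar> * M n i)" for n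
  proof -
    have "summable (\<lambda>i. C * M n i)"
      using M by (intro summable_mult) (auto simp: sums_iff)
    thus "summable (\<lambda>i. (e i - L) * M n i)" "summable (\<lambda>i. \<bar>e i - L\<bar> * M n i)"
      by (rule summable_comparison_test', use C M_nonneg in \<open>auto simp: abs_mult intro!: mult_right_mono\<close>)+
  qed
  have eq: "(\<Sum>i. e i * M n i) = (\<Sum>i. (e i - L) * M n i) + L * S n" for n
  proof -
    have "(\<lambda>i. (e i - L) * M n i + L * M n i) sums ((\<Sum>i. (e i - L) * M n i) + L * S n)"
      by (intro sums_add sums_mult M summable_sums summ)
    thus ?thesis by (simp add: sums_iff algebra_simps)
  qed
  have "(\<lambda>n. \<Sum>i. (e i - L) * M n i) \<longlonglongrightarrow> 0"
  proof (rule LIMSEQ_I)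
    fix r :: real assume r: "r > 0"
    \<comment> \<open>The summand 1 keeps the denominator positive when \<sigma> = 0; in all cases
      \<delta> \<sigma> is at most r / 2, which leaves room for the finitely many columns below
      \<open>I\<close>.\<close>
    define \<delta> where "\<delta> = r / (2 * (\<bar>\<sigma>\<bar> + 1))"
    have \<delta>: "\<delta> > 0" using r by (simp add: \<delta>_def add_nonneg_pos)
    obtain I where I: "\<And>i. i \<ge> I \<Longrightarrow> \<bar>e i - L\<bar> < \<delta>"
      using LIMSEQ_D[OF e \<delta>] by auto
    have "(\<lambda>n. \<delta> * S n + (\<Sum>i<I. C * M n i)) \<longlonglongrightarrow> \<delta> * \<sigma> + (\<Sum>i<I. C * 0)"
      by (intro tendsto_intros S cols)
    moreover have "\<delta> * \<sigma> < r"
    proof -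
      have "\<delta> * \<sigma> \<le> \<delta> * (\<bar>\<sigma>\<bar> + 1)"
        using \<delta> by (intro mult_left_mono) auto
      also have "\<dots> = r / 2" by (simp add: \<delta>_def field_simps)
      finally show ?thesis using r by linarith
    qed
    ultimately have "eventually (\<lambda>n. \<delta> * S n + (\<Sum>i<I. C * M n i) < r) sequentially"
      by (intro order_tendstoD(2)[where y = "\<delta> * \<sigma>"]) auto
    then obtain n0 where n0: "\<And>n. n \<ge> n0 \<Longrightarrow> \<delta> * S n + (\<Sum>i<I. C * M n i) < r"
      by (auto simp: eventually_at_top_linorder)
    have "norm (\<Sum>i. (e i - L) * M n i) \<le> \<delta> * S n + (\<Sum>i<I. C * M n i)" for n
    proof -
      have fin: "(\<lambda>i. if i \<in> {..<I} then C * M n i else 0) sums (\<Sum>i<I. C * M n i)"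
        by (rule sums_If_finite_set) auto
      have tot: "(\<lambda>i. \<delta> * M n i + (if i \<in> {..<I} then C * M n i else 0)) sums (\<delta> * S n + (\<Sum>i<I. C * M n i))"
        by (intro sums_add sums_mult M fin)
      have "norm (\<Sum>i. (e i - L) * M n i) \<le> (\<Sum>i. \<delta> * M n i + (if i \<in> {..<I} then C * M n i else 0))"
      proof (rule norm_suminf_le)
        fix i
        show "norm ((e i - L) * M n i) \<le> \<delta> * M n i + (if i \<in> {..<I} then C * M n i else 0)"
        proof (cases "i < I")
          case True
          have "\<bar>e i - L\<bar> * M n i \<le> C * M n i" using C M_nonneg by (intro mult_right_mono) auto
          moreover have "\<delta> * M n i \<ge> 0" using \<delta> M_nonneg by auto
          ultimately show ?thesis using True M_nonneg[of n i] by (simp add: abs_mult)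
        next
          case False
          have "\<bar>e i - L\<bar> * M n i \<le> \<delta> * M n i"
            using I[of i] False M_nonneg by (intro mult_right_mono) auto
          thus ?thesis using False M_nonneg[of n i] by (simp add: abs_mult)
        qed
      qed (use tot in \<open>simp add: sums_iff\<close>)
      thus ?thesis using tot by (simp add: sums_iff)
    qed
    thus "\<exists>no. \<forall>n\<ge>no. norm ((\<Sum>i. (e i - L) * M n i) - 0) < r"
      using n0 by (intro exI[of _ n0]) (auto intro: le_less_trans)
  qed
  from tendsto_add[OF this tendsto_mult[OF tendsto_const[of L] S]]
  show ?thesis by (simp add: eq)
qed


text \<open>In \<open>Gamma_series (1 - t) n ^ 2 / Gamma_series (1 - 2 * t) n\<close> the powers of
  n combine to n^(2 - 2t - (1 - 2t)) = n. The rational factor removes this n together with the last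
  Pochhammer factors.\<close>

lemma pochhammer_quotient_tendsto_Gamma:
  fixes t :: real
  assumes "0 < t" "t < 1 / 2"
  shows "(\<lambda>n. pochhammer (1 - 2 * t) n / pochhammer (1 - t) n / (pochhammer (1 - t) n / fact n))
           \<longlonglongrightarrow> Gamma (1 - t) ^ 2 / Gamma (1 - 2 * t)"
proof -
  have "(\<lambda>n. Gamma_series (1 - t) n ^ 2 / Gamma_series (1 - 2 * t) n *
             ((1 - t + real n) ^ 2 / (real n * (1 - 2 * t + real n)))) \<longlonglongrightarrow> 
        Gamma (1 - t) ^ 2 / Gamma (1 - 2 * t) * 1"
  proof (intro tendsto_intros)
    show "Gamma (1 - 2 * t) \<noteq> 0"
      using Gamma_real_pos[of "1 - 2 * t"] assms by linarith
    show "(\<lambda>n. (1 - t + real n) ^ 2 / (real n * (1 - 2 * t + real n))) \<longlonglongrightarrow> 1"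
      by real_asymp
  qed
  moreover have "eventually (\<lambda>n. Gamma_series (1 - t) n ^ 2 / Gamma_series (1 - 2 * t) n *
             ((1 - t + real n) ^ 2 / (real n * (1 - 2 * t + real n))) =
             pochhammer (1 - 2 * t) n / pochhammer (1 - t) n / (pochhammer (1 - t) n / fact n)) sequentially"
    using eventually_gt_at_top[of 0]
  proof eventually_elim
    case (elim n)
    define E where "E = exp ((1 - t) * ln (real n))"
    have p: "pochhammer (1 - t) n > 0" "pochhammer (1 - 2 * t) n > 0" "1 - t + real n > 0" "1 - 2 * t + real n > 0"
      using assms by (auto intro!: pochhammer_pos)
    have "exp ((1 - 2 * t) * ln (real n)) * real n = exp ((1 - 2 * t) * ln (real n) + ln (real n))"
      using elim by (simp add: exp_add)
    also have "\<dots> = exp ((1 - t) * ln (real n) + (1 - t) * ln (real n))"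
      by (simp add: algebra_simps)
    also have "\<dots> = E * E" unfolding E_def by (rule exp_add)
    finally have F: "exp ((1 - 2 * t) * ln (real n)) = E * E / real n"
      using elim by (simp add: field_simps)
    have E: "E > 0" by (simp add: E_def)
    show ?case
      using p E elim unfolding Gamma_series_def pochhammer_Suc Suc_eq_plus1[symmetric]
      by (simp add: F flip: E_def) (simp add: power2_eq_square)
  qed
  ultimately show ?thesis
    by (simp add: Lim_transform_eventually)
qed

text \<open>
  With \<Phi> n = a n * (\<Sum>i. c i / (n + i + 1 - 2 t)), the differences \<Phi> n - \<Phi> (n + 1) are the
  terms on the left, \<Phi> 0 is the sum on the right, and the limit of \<Phi> is the Gamma factor.
\<close>

lemma pochhammer_transfer_sums:
  fixes t :: real
  assumes t: "0 < t" "t < 1 / 2"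
  defines "a \<equiv> (\<lambda>n. fact n / pochhammer (1 - t) n)"
    and "c \<equiv> (\<lambda>n. pochhammer (1 - 2 * t) n / pochhammer (1 - t) n)"
  shows "(\<lambda>n. t * a n / ((real (Suc n) - t) * (real (Suc n) - 2 * t))) sums
           ((\<Sum>i. c i / (real (Suc i) - 2 * t)) - Gamma (1 - t) ^ 2 / Gamma (1 - 2 * t) * Beta (1 - t) t)"
proof -
  define w where "w n = pochhammer (1 - t) n / fact n" for n
  have apos: "a n > 0" and wpos: "w n > 0" for n
    using t by (auto simp: a_def w_def intro!: divide_pos_pos pochhammer_pos)
  define \<Phi> where "\<Phi> n = (\<Sum>i. a n * c i / (real n + real (Suc i) - 2 * t))" for n
  have c_summ: "summable (\<lambda>i. c i / (z + real i))" if "z > 0" for z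
    unfolding c_def using t that by (intro summable_pochhammer_ratio_div) auto
  have summ: "summable (\<lambda>i. a n * c i / (real n + real (Suc i) - 2 * t))" for n
    using summable_mult[OF c_summ[of "real n + 1 - 2 * t"], of "a n"] t
    by (simp add: algebra_simps)
  \<comment> \<open>Writing \<open>c i\<close> as \<open>c i / w i\<close> times \<open>w i\<close>
    separates a convergent sequence from weights whose row sums are values of
    \<open>gauss_sum (1 - t)\<close>.\<close>
  define M where "M n i = a n * (w i / (real i + (1 - 2 * t + real n)))" for n i
  have lim: "\<Phi> \<longlonglongrightarrow> Gamma (1 - t) ^ 2 / Gamma (1 - 2 * t) * Beta (1 - t) t"
  proof -
    have "(\<lambda>n. \<Sum>i. c i / w i * M n i) \<longlonglongrightarrow> Gamma (1 - t) ^ 2 / Gamma (1 - 2 * t) * Beta (1 - t) t"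
    proof (rule toeplitz_tendsto)
      show "M n i \<ge> 0" for n i
        using apos[of n] wpos[of i] t by (simp add: M_def)
      show "M n sums (a n * gauss_sum (1 - t) (1 - 2 * t + real n))" for n
        unfolding M_def[abs_def] w_def gauss_sum_def using t
        by (intro sums_mult summable_sums summable_gauss_sum) auto
      \<comment> \<open>At N = 1 - t the shift factor is exactly \<open>a n\<close>, so
        \<open>a n * gauss_sum (1 - t) (1 - t + n)\<close> is the constant
        \<open>Beta (1 - t) t\<close>. Replacing 1 - t + n by 1 - 2t + n costs a factor tending to
        1.\<close>
      have "a n * gauss_sum (1 - t) (1 - 2 * t + real n) =
              Beta (1 - t) t * (gauss_sum (1 - t) (1 - 2 * t + real n) / gauss_sum (1 - t) (1 - t + real n))" for n
      proof -
        have "gauss_sum (1 - t) (1 - t) * pochhammer (1 - t) n = fact n * gauss_sum (1 - t) (1 - t + real n)"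
          using gauss_sum_shift[of "1 - t" "1 - t" n] t by (simp flip: pochhammer_fact)
        moreover have "pochhammer (1 - t) n > 0" "gauss_sum (1 - t) (1 - t + real n) > 0"
          using t by (auto intro!: pochhammer_pos gauss_sum_pos)
        moreover have "gauss_sum (1 - t) (1 - t) = Beta (1 - t) t"
          using t by (subst gauss_sum_eq_Beta) auto
        ultimately show ?thesis
          by (simp add: a_def field_simps)
      qed
      moreover have "(\<lambda>n. Beta (1 - t) t * (gauss_sum (1 - t) (1 - 2 * t + real n) / gauss_sum (1 - t) (1 - t + real n)))
              \<longlonglongrightarrow> Beta (1 - t) t * 1"
        using t by (intro tendsto_mult tendsto_const gauss_sum_quotient_tendsto_1) auto
      ultimately show "(\<lambda>n. a n * gauss_sum (1 - t) (1 - 2 * t + real n)) \<longlonglongrightarrow> Beta (1 - t) t"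
        by simp
      show "(\<lambda>n. M n i) \<longlonglongrightarrow> 0" for i
      proof -
        \<comment> \<open>\<open>a n\<close> itself grows. The denominator of \<open>M n i\<close>,
          which is linear in n, pays for raising \<open>pochhammer (1 - t) n\<close> to
          \<open>pochhammer (2 - t) n\<close>, and then the quotient tends to 0.\<close>
        have 1: "(\<lambda>n. fact n / pochhammer (2 - t) n) \<longlonglongrightarrow> 0"
          using pochhammer_ratio_tendsto_0[of 1 "2 - t"] t by (simp flip: pochhammer_fact)
        have "(\<lambda>n. w i * (1 - t + real n) / (1 - t) / (real i + (1 - 2 * t + real n))) \<longlonglongrightarrow> w i * inverse (1 - t)"
          using t by real_asymp
        from tendsto_mult[OF 1 this]
        have "(\<lambda>n. fact n / pochhammer (2 - t) n * (w i * (1 - t + real n) / (1 - t) / (real i + (1 - 2 * t + real n)))) \<longlonglongrightarrow> 0"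
          by simp
        moreover have "fact n / pochhammer (2 - t) n * (w i * (1 - t + real n) / (1 - t) / (real i + (1 - 2 * t + real n))) = M n i" for n
        proof -
          have "(1 - t) * pochhammer (2 - t) n = pochhammer (1 - t) n * (1 - t + real n)"
            using pochhammer_rec[of "1 - t" n] pochhammer_Suc[of "1 - t" n] by simp
          moreover have "pochhammer (1 - t) n > 0"
            using t by (intro pochhammer_pos) auto
          moreover have "1 - t > 0" "1 - t + real n > 0" using t by auto
          ultimately have "pochhammer (2 - t) n = pochhammer (1 - t) n * (1 - t + real n) / (1 - t)"
            by (simp add: field_simps)
          with \<open>1 - t > 0\<close> \<open>1 - t + real n > 0\<close> show ?thesis
            by (simp add: M_def a_def)
        qed
        ultimately show ?thesis by simp
      qed
      show "(\<lambda>i. c i / w i) \<longlonglongrightarrow> Gamma (1 - t) ^ 2 / Gamma (1 - 2 * t)"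
        unfolding c_def w_def by (rule pochhammer_quotient_tendsto_Gamma[OF t])
    qed
    moreover have "c i / w i * M n i = a n * c i / (real n + real (Suc i) - 2 * t)" for n i
      using wpos[of i] by (simp add: M_def algebra_simps)
    ultimately show ?thesis
      by (simp add: \<Phi>_def[abs_def])
  qed
  have "\<Phi> n - \<Phi> (Suc n) = t * a n / ((real (Suc n) - t) * (real (Suc n) - 2 * t))" for n
  proof -
    define m where "m = real (Suc n)"
    have m: "m - t > 0" "m - 2 * t > 0" using t by (auto simp: m_def)
    \<comment> \<open>For fixed n this telescopes in i, by c(i + 1) (i + 1 - t) = c(i) (i + 1 - 2t).
      The boundary value \<open>V 0 = - t / (m - 2 * t)\<close> alone produces the term of the
      a-series.\<close>
    define V where "V i = c i * (real i - t) / (m + real i - 2 * t)" for i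
    have "(\<lambda>i. (real i - t) / (m + real i - 2 * t)) \<longlonglongrightarrow> 1"
      by real_asymp
    moreover have "c \<longlonglongrightarrow> 0"
      unfolding c_def using t by (intro pochhammer_ratio_tendsto_0) auto
    ultimately have V: "V \<longlonglongrightarrow> 0"
      using tendsto_mult[of c 0 sequentially "\<lambda>i. (real i - t) / (m + real i - 2 * t)" 1] by (simp add: V_def[abs_def])
    have step: "V (Suc i) - V i = c i * ((m - t) / (m + real i - 2 * t) - m / (m + real (Suc i) - 2 * t))" for i
    proof -
      have pos: "m + real i - 2 * t > 0" "m + real (Suc i) - 2 * t > 0" "real (Suc i) - t > 0" using m t by auto
      have "c (Suc i) = c i * ((real (Suc i) - 2 * t) / (real (Suc i) - t))"
        by (simp add: c_def pochhammer_Suc algebra_simps)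
      hence "c (Suc i) * (real (Suc i) - t) = c i * (real (Suc i) - 2 * t)"
        using pos by simp
      hence "V (Suc i) = c i * ((real (Suc i) - 2 * t) / (m + real (Suc i) - 2 * t))"
        by (simp add: V_def)
      also have "(real (Suc i) - 2 * t) / (m + real (Suc i) - 2 * t) = 1 - m / (m + real (Suc i) - 2 * t)"
        using pos by (simp add: field_simps)
      finally have 1: "V (Suc i) = c i * (1 - m / (m + real (Suc i) - 2 * t))" .
      have "(real i - t) / (m + real i - 2 * t) = 1 - (m - t) / (m + real i - 2 * t)"
        using pos by (simp add: field_simps)
      hence "V i = c i * (1 - (m - t) / (m + real i - 2 * t))"
        by (simp only: V_def times_divide_eq_right[symmetric])
      with 1 show ?thesis by (simp add: algebra_simps)
    qed
    have "(\<lambda>i. V (Suc i) - V i) sums (0 - V 0)"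
      by (rule telescope_sums[OF V])
    hence "(\<lambda>i. a n / (m - t) * (V (Suc i) - V i)) sums (a n / (m - t) * (0 - V 0))"
      by (rule sums_mult)
    moreover have "a n / (m - t) * (V (Suc i) - V i) =
        a n * c i / (real n + real (Suc i) - 2 * t) - a (Suc n) * c i / (real (Suc n) + real (Suc i) - 2 * t)" for i
    proof -
      have 1: "a (Suc n) = a n / (m - t) * m"
        by (simp add: a_def m_def pochhammer_Suc algebra_simps)
      have 2: "real n + real (Suc i) - 2 * t = m + real i - 2 * t"
        by (simp add: m_def)
      have 3: "a n = a n / (m - t) * (m - t)"
        using m by simp
      have "a n * c i / (m + real i - 2 * t) = a n / (m - t) * (c i * ((m - t) / (m + real i - 2 * t)))"
        by (subst 3) (simp only: times_divide_eq_right times_divide_eq_left mult_ac)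
      thus ?thesis
        unfolding step 1 2 m_def[symmetric] by (simp only: right_diff_distrib times_divide_eq_right times_divide_eq_left mult_ac)
    qed
    moreover have "(\<lambda>i. a n * c i / (real n + real (Suc i) - 2 * t) - a (Suc n) * c i / (real (Suc n) + real (Suc i) - 2 * t))
        sums (\<Phi> n - \<Phi> (Suc n))"
      unfolding \<Phi>_def by (intro sums_diff summable_sums summ)
    ultimately have "\<Phi> n - \<Phi> (Suc n) = a n / (m - t) * (0 - V 0)"
      by (simp add: sums_iff)
    also have "\<dots> = t * a n / ((m - t) * (m - 2 * t))"
      by (simp add: V_def c_def)
    finally show ?thesis by (simp add: m_def)
  qed
  with telescope_sums'[OF lim] show ?thesis
    by (simp add: \<Phi>_def a_def)
qed

section \<open>Gamma factors and the generating function identity\<close>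

text \<open>This is \<open>y * gauss_sum x (- y)\<close> without its term k = 0, which equals -1 and
  yields the 1 on the right; one step of the recurrence moves the argument to
  \<open>1 - y > 0\<close>. For 1 - x - y > 0 the subtracted product is \<Gamma>(1 - x) \<Gamma>(1 -
  y) / \<Gamma>(1 - x - y); the Beta form stays away from the poles of \<Gamma>.\<close>

lemma gauss_series_Beta:
  fixes x y :: real
  assumes x: "0 < x" "x < 1" and y: "\<bar>y\<bar> < 1" "y \<noteq> 0"
  shows "(\<lambda>i. x * y * (pochhammer (1 + x) i / fact i / (real (Suc i) * (real (Suc i) - y)))) sums
           (1 - (1 - x - y) * Beta (1 - y) (1 - x))"
proof -
  have "(\<lambda>k. y * (pochhammer x k / fact k / (real k + (- y)))) sums (y * gauss_sum x (- y))"
    unfolding gauss_sum_def using x y by (intro sums_mult summable_sums summable_gauss_sum) auto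
  hence "(\<lambda>k. y * (pochhammer x (Suc k) / fact (Suc k) / (real (Suc k) + (- y)))) sums
           (y * gauss_sum x (- y) - y * (pochhammer x 0 / fact 0 / (real 0 + (- y))))"
    by (subst sums_Suc_iff) simp
  also have "(\<lambda>k. y * (pochhammer x (Suc k) / fact (Suc k) / (real (Suc k) + (- y)))) =
             (\<lambda>i. x * y * (pochhammer (1 + x) i / fact i / (real (Suc i) * (real (Suc i) - y))))"
    by (simp add: fun_eq_iff pochhammer_rec add_ac mult_ac)
  also have "y * gauss_sum x (- y) = - ((1 - x - y) * gauss_sum x (1 - y))"
    using gauss_sum_recurrence[of x "- y"] x y by (simp add: algebra_simps)
  also have "gauss_sum x (1 - y) = Beta (1 - y) (1 - x)"
    using x y by (intro gauss_sum_eq_Beta) auto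
  finally show ?thesis using y by simp
qed

text \<open>The factor t turns \<open>Beta (1 - t) t\<close> = \<Gamma>(1 - t) \<Gamma>(t) into
  \<Gamma>(1 - t) \<Gamma>(1 + t). So the two factors are Gauss' formula at (x, y) = (t, -t) and at
  (t, t).\<close>

lemma Gamma_quotient_eq:
  fixes t zm zp :: real
  assumes t: "0 < t" "t < 1 / 2"
    and zm: "(\<lambda>i. pochhammer (1 + t) i / fact i / (real (Suc i) * (real (Suc i) + t))) sums zm"
    and zp: "(\<lambda>i. pochhammer (1 + t) i / fact i / (real (Suc i) * (real (Suc i) - t))) sums zp"
  shows "t * (Gamma (1 - t) ^ 2 / Gamma (1 - 2 * t) * Beta (1 - t) t) = (1 + t\<^sup>2 * zm) * (1 - t\<^sup>2 * zp)"
proof -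
  have nonpos: "z \<notin> \<int>\<^sub>\<le>\<^sub>0" if "z > 0" for z :: real
    using that by (auto elim!: nonpos_Ints_cases)
  have pos: "Gamma t > 0" "Gamma (1 - t) > 0" "Gamma (1 - 2 * t) > 0"
    using t by (auto intro!: Gamma_real_pos)
  have "t * (- t) * zm = 1 - (1 - t - (- t)) * Beta (1 - (- t)) (1 - t)"
    using sums_unique2[OF sums_mult[OF zm, of "t * (- t)"]] gauss_series_Beta[of t "- t"] t by auto
  moreover have "Gamma (1 + t) = t * Gamma t"
    using t Gamma_plus1[of t] nonpos[of t] by (simp add: add_ac)
  moreover have "Gamma (2 :: real) = 1"
    using Gamma_fact[of 1, where 'a = real] by simp
  ultimately have "1 + t\<^sup>2 * zm = t * Gamma t * Gamma (1 - t)"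
    by (simp add: Beta_def power2_eq_square)
  moreover have "t * t * zp = 1 - (1 - t - t) * Beta (1 - t) (1 - t)"
    using sums_unique2[OF sums_mult[OF zp, of "t * t"]] gauss_series_Beta[of t t] t by auto
  moreover have "Gamma (2 - 2 * t) = (1 - 2 * t) * Gamma (1 - 2 * t)"
    using t Gamma_plus1[of "1 - 2 * t"] nonpos[of "1 - 2 * t"] by simp
  hence "(1 - t - t) * Beta (1 - t) (1 - t) = Gamma (1 - t) ^ 2 / Gamma (1 - 2 * t)"
    using t pos by (simp add: Beta_def power2_eq_square)
  ultimately show ?thesis
    by (simp add: Beta_def power2_eq_square)
qed

lemma generating_function_identity:
  fixes t zm zp s1 s2 :: real
  assumes t: "0 < t" "t < 1 / 2"
    and zm: "(\<lambda>i. pochhammer (1 + t) i / fact i / (real (Suc i) * (real (Suc i) + t))) sums zm"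
    and zp: "(\<lambda>i. pochhammer (1 + t) i / fact i / (real (Suc i) * (real (Suc i) - t))) sums zp"
    and s1: "(\<lambda>i. 1 / (real (Suc i) - t)\<^sup>2) sums s1"
    and s2: "(\<lambda>i. 1 / ((real (Suc i))\<^sup>2 - t\<^sup>2)) sums s2"
  defines "a \<equiv> (\<lambda>n. fact n / pochhammer (1 - t) n)"
    and "c \<equiv> (\<lambda>n. pochhammer (1 - 2 * t) n / pochhammer (1 - t) n)"
  shows "(\<lambda>i. 2 / (real (Suc i) * (real (Suc i) - 2 * t)) * (a i - c i)) sums
           (zp - zm + t\<^sup>2 * (zm * zp) + s1 - s2)"
proof -
  have a1: "(\<lambda>i. a i / (real (Suc i) * (real (Suc i) - t))) sums s1"
  proof -
    note * = pochhammer_double_telescope[of 0 "1 - t"]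
    have "(\<lambda>n. 1 / ((1 - t + real n - 0) * (1 - t + real n))) = (\<lambda>i. 1 / (real (Suc i) - t)\<^sup>2)"
      by (simp add: fun_eq_iff power2_eq_square algebra_simps)
    hence "(\<lambda>i. pochhammer (0 + 1) i / (real (Suc i) * pochhammer (1 - t) (Suc i))) sums s1"
      using * t sums_unique2[OF s1] by (simp add: sums_iff)
    also have "(\<lambda>i. pochhammer (0 + 1) i / (real (Suc i) * pochhammer (1 - t) (Suc i))) =
               (\<lambda>i. a i / (real (Suc i) * (real (Suc i) - t)))"
      by (simp add: fun_eq_iff a_def pochhammer_Suc algebra_simps flip: pochhammer_fact)
    finally show ?thesis .
  qed
  have c1: "(\<lambda>i. t * (c i / real (Suc i))) sums (1 - t\<^sup>2 * s2)"
  proof -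
    \<comment> \<open>With \<alpha> = -2t and \<beta> = -t, the term n = 0 is -1 / t^2 and the terms
      n \<ge> 1 are 1 / (n^2 - t^2). After multiplication by -t^2 the term n = 0 becomes the
      constant 1.\<close>
    have "- 1 < - 2 * t" "- 2 * t < - t" "- t \<noteq> 0" using t by auto
    note * = pochhammer_double_telescope[OF this]
    have "(\<lambda>n. 1 / ((- t + real (Suc n) - (- 2 * t)) * (- t + real (Suc n)))) = (\<lambda>i. 1 / ((real (Suc i))\<^sup>2 - t\<^sup>2))"
      by (simp add: fun_eq_iff power2_eq_square algebra_simps)
    with s2 have "(\<lambda>n. 1 / ((- t + real (Suc n) - (- 2 * t)) * (- t + real (Suc n)))) sums s2"
      by simp
    hence "(\<lambda>n. 1 / ((- t + real n - (- 2 * t)) * (- t + real n))) sums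
             (s2 + 1 / ((- t + real 0 - (- 2 * t)) * (- t + real 0)))"
      by (subst (asm) sums_Suc_iff)
    hence "(\<lambda>i. pochhammer (- 2 * t + 1) i / (real (Suc i) * pochhammer (- t) (Suc i))) sums (s2 - 1 / t\<^sup>2)"
      using * sums_unique2 by (fastforce simp: sums_iff power2_eq_square)
    hence "(\<lambda>i. - (t\<^sup>2) * (pochhammer (- 2 * t + 1) i / (real (Suc i) * pochhammer (- t) (Suc i)))) sums
             (- (t\<^sup>2) * (s2 - 1 / t\<^sup>2))"
      by (rule sums_mult)
    also have "(\<lambda>i. - (t\<^sup>2) * (pochhammer (- 2 * t + 1) i / (real (Suc i) * pochhammer (- t) (Suc i)))) =
               (\<lambda>i. t * (c i / real (Suc i)))"
      using t by (simp add: fun_eq_iff c_def pochhammer_rec power2_eq_square add_ac)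
    finally show ?thesis using t by (simp add: right_diff_distrib)
  qed
  define T where "T = (\<Sum>i. c i / (real (Suc i) - 2 * t))"
  have "summable (\<lambda>i. c i / (1 - 2 * t + real i))"
    unfolding c_def using t by (intro summable_pochhammer_ratio_div) auto
  hence c2: "(\<lambda>i. c i / (real (Suc i) - 2 * t)) sums T"
    unfolding T_def by (intro summable_sums) (simp add: algebra_simps)
  define G where "G = Gamma (1 - t) ^ 2 / Gamma (1 - 2 * t) * Beta (1 - t) t"
  have a2: "(\<lambda>i. t * a i / ((real (Suc i) - t) * (real (Suc i) - 2 * t))) sums (T - G)"
    using pochhammer_transfer_sums[OF t] by (simp add: a_def c_def T_def G_def)
  \<comment> \<open>This combination is t^2 times the claimed series. The unevaluated
    \<open>T\<close> enters once through the transport and once directly, and cancels. The constant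
    1 from \<open>c1\<close> and the product t G then give t^2 (zp - zm + t^2 zm zp).\<close>
  have "(\<lambda>i. t * (t * a i / ((real (Suc i) - t) * (real (Suc i) - 2 * t)))
             + t\<^sup>2 * (a i / (real (Suc i) * (real (Suc i) - t)))
             - t * (c i / (real (Suc i) - 2 * t)) + t * (c i / real (Suc i))) sums
          (t * (T - G) + t\<^sup>2 * s1 - t * T + (1 - t\<^sup>2 * s2))"
    by (intro sums_add sums_diff sums_mult a1 a2 c2 c1)
  hence "(\<lambda>i. (t * (t * a i / ((real (Suc i) - t) * (real (Suc i) - 2 * t)))
             + t\<^sup>2 * (a i / (real (Suc i) * (real (Suc i) - t)))
             - t * (c i / (real (Suc i) - 2 * t)) + t * (c i / real (Suc i))) / t\<^sup>2) sums
          ((t * (T - G) + t\<^sup>2 * s1 - t * T + (1 - t\<^sup>2 * s2)) / t\<^sup>2)"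
    by (rule sums_divide)
  also have "(\<lambda>i. (t * (t * a i / ((real (Suc i) - t) * (real (Suc i) - 2 * t)))
             + t\<^sup>2 * (a i / (real (Suc i) * (real (Suc i) - t)))
             - t * (c i / (real (Suc i) - 2 * t)) + t * (c i / real (Suc i))) / t\<^sup>2) =
             (\<lambda>i. 2 / (real (Suc i) * (real (Suc i) - 2 * t)) * (a i - c i))"
  proof
    fix i
    define k where "k = real (Suc i)"
    have k: "k > 0" "k - t > 0" "k - 2 * t > 0" using t by (auto simp: k_def)
    have 1: "t / ((k - t) * (k - 2 * t)) = 1 / (k - 2 * t) - 1 / (k - t)"
      using k by (simp add: divide_simps) (simp add: algebra_simps)?
    have 2: "t / (k * (k - t)) = 1 / (k - t) - 1 / k"
      using k by (simp add: divide_simps) (simp add: algebra_simps)?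
    have 3: "2 * t / (k * (k - 2 * t)) = 1 / (k - 2 * t) - 1 / k"
      using k by (simp add: divide_simps) (simp add: algebra_simps)?
    have "(t * (t * a i / ((k - t) * (k - 2 * t))) + t\<^sup>2 * (a i / (k * (k - t)))
             - t * (c i / (k - 2 * t)) + t * (c i / k)) =
          t * (a i * (t / ((k - t) * (k - 2 * t)) + t / (k * (k - t))) - c i * (1 / (k - 2 * t) - 1 / k))"
      by (simp add: algebra_simps power2_eq_square)
    also have "\<dots> = t * (2 * t / (k * (k - 2 * t)) * (a i - c i))"
    proof -
      have "a i * ((X - Y) + (Y - Z)) - c i * (X - Z) = (X - Z) * (a i - c i)" for X Y Z
        by (simp add: algebra_simps)
      thus ?thesis unfolding 1 2 3 by (simp only:)
    qed
    finally have "(t * (t * a i / ((k - t) * (k - 2 * t))) + t\<^sup>2 * (a i / (k * (k - t)))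
             - t * (c i / (k - 2 * t)) + t * (c i / k)) / t\<^sup>2 = 2 / (k * (k - 2 * t)) * (a i - c i)"
      using t by (simp add: power2_eq_square)
    thus "(t * (t * a i / ((real (Suc i) - t) * (real (Suc i) - 2 * t)))
             + t\<^sup>2 * (a i / (real (Suc i) * (real (Suc i) - t)))
             - t * (c i / (real (Suc i) - 2 * t)) + t * (c i / real (Suc i))) / t\<^sup>2 =
          2 / (real (Suc i) * (real (Suc i) - 2 * t)) * (a i - c i)"
      by (simp only: k_def)
  qed
  also have "(t * (T - G) + t\<^sup>2 * s1 - t * T + (1 - t\<^sup>2 * s2)) / t\<^sup>2 =
             zp - zm + t\<^sup>2 * (zm * zp) + s1 - s2"
  proof -
    have "t * (T - G) + t\<^sup>2 * s1 - t * T + (1 - t\<^sup>2 * s2) = 1 - t * G + t\<^sup>2 * (s1 - s2)"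
      by (simp add: algebra_simps)
    also have "t * G = (1 + t\<^sup>2 * zm) * (1 - t\<^sup>2 * zp)"
      unfolding G_def by (rule Gamma_quotient_eq[OF t zm zp])
    also have "1 - (1 + t\<^sup>2 * zm) * (1 - t\<^sup>2 * zp) + t\<^sup>2 * (s1 - s2) =
               (zp - zm + t\<^sup>2 * (zm * zp) + s1 - s2) * t\<^sup>2"
      by (simp add: algebra_simps)
    finally show ?thesis using t by simp
  qed
  finally show ?thesis .
qed

section \<open>Rearrangement of series\<close>

lemma has_sum_product_real:
  fixes f :: "'a \<Rightarrow> real" and g :: "'b \<Rightarrow> real"
  assumes f: "(f has_sum a) A" and g: "(g has_sum b) B"
  shows "((\<lambda>(x, y). f x * g y) has_sum (a * b)) (A \<times> B)"
proof (rule has_sum_SigmaI)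
  show "((\<lambda>y. case (x, y) of (x, y) \<Rightarrow> f x * g y) has_sum f x * b) B" for x
    using has_sum_cmult_right[OF g, of "f x"] by simp
  show "((\<lambda>x. f x * b) has_sum a * b) A"
    by (rule has_sum_cmult_left[OF f])
  have fa: "(\<lambda>x. \<bar>f x\<bar>) summable_on A" and ga: "(\<lambda>x. \<bar>g x\<bar>) summable_on B"
    using f g summable_on_iff_abs_summable_on_real[of f A] summable_on_iff_abs_summable_on_real[of g B]
    by (auto dest: has_sum_imp_summable)
  have "(\<lambda>z. \<bar>case z of (x, y) \<Rightarrow> f x * g y\<bar>) summable_on A \<times> B"
  proof (rule summable_on_SigmaI)
    show "((\<lambda>y. \<bar>case (x, y) of (x, y) \<Rightarrow> f x * g y\<bar>) has_sum \<bar>f x\<bar> * infsum (\<lambda>y. \<bar>g y\<bar>) B) B" for x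
      using has_sum_cmult_right[OF has_sum_infsum[OF ga], of "\<bar>f x\<bar>"] by (simp add: abs_mult)
    show "(\<lambda>x. \<bar>f x\<bar> * infsum (\<lambda>y. \<bar>g y\<bar>) B) summable_on A"
      by (rule summable_on_cmult_left[OF fa])
  qed auto
  thus "(\<lambda>(x, y). f x * g y) summable_on A \<times> B"
    using summable_on_iff_abs_summable_on_real[of "\<lambda>(x, y). f x * g y" "A \<times> B"] by simp
qed

text \<open>Fubini for signed weights \<open>u\<close>: the sums \<open>G\<close> for |u| give
  absolute summability over all pairs (i, z). In the applications i + 1 is the largest summation
  index of a multiple zeta value \<open>m z\<close>, z encodes the exponents, and \<open>u z\<close>
  carries the power of t.\<close>

lemma has_sum_exchange_weighted:
  fixes c :: "nat \<Rightarrow> 'b \<Rightarrow> real" and u :: "'b \<Rightarrow> real"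
  assumes c: "\<And>i z. z \<in> B \<Longrightarrow> c i z \<ge> 0"
    and abs: "\<And>i. ((\<lambda>z. c i z * \<bar>u z\<bar>) has_sum G i) B" and G: "summable G"
    and H: "\<And>i. ((\<lambda>z. c i z * u z) has_sum H i) B" and S: "H sums S"
    and m: "\<And>z. z \<in> B \<Longrightarrow> (\<lambda>i. c i z) sums m z"
  shows "((\<lambda>z. m z * u z) has_sum S) B"
proof -
  have G_nonneg: "G i \<ge> 0" for i
    using abs[of i] by (rule has_sum_nonneg) (use c in auto)
  have HG: "\<bar>H i\<bar> \<le> G i" for i
  proof -
    have "((\<lambda>z. - (c i z * u z)) has_sum - H i) B"
      using H by (simp add: has_sum_uminus)
    hence "- H i \<le> G i"
    proof (rule has_sum_mono[OF _ abs])
      fix z assume "z \<in> B"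
      thus "- (c i z * u z) \<le> c i z * \<bar>u z\<bar>"
        using mult_left_mono[of "- u z" "\<bar>u z\<bar>" "c i z"] c[of z i] by simp
    qed
    moreover have "H i \<le> G i"
      by (rule has_sum_mono[OF H abs]) (use c in \<open>auto intro: mult_left_mono\<close>)
    ultimately show ?thesis by linarith
  qed
  have "summable (\<lambda>i. norm (H i))"
    by (rule summable_comparison_test'[OF G]) (use HG in auto)
  hence HS: "(H has_sum S) UNIV"
    using S by (rule norm_summable_imp_has_sum)
  have "(\<lambda>(i, z). c i z * \<bar>u z\<bar>) summable_on UNIV \<times> B"
    by (rule summable_on_SigmaI[where g = G])
       (use abs c G G_nonneg in \<open>auto intro: summable_nonneg_imp_summable_on\<close>)
  hence "(\<lambda>x. norm ((\<lambda>(i, z). c i z * u z) x)) summable_on UNIV \<times> B"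
    by (rule summable_on_cong[THEN iffD1, rotated]) (use c in \<open>auto simp: abs_mult\<close>)
  hence "(\<lambda>(i, z). c i z * u z) summable_on UNIV \<times> B"
    using summable_on_iff_abs_summable_on_real by blast
  hence "((\<lambda>(i, z). c i z * u z) has_sum S) (UNIV \<times> B)"
    by (intro has_sum_SigmaI[where g = H] HS) (use H in auto)
  hence "((\<lambda>(z, i). c i z * u z) has_sum S) (B \<times> UNIV)"
    by (subst (asm) has_sum_swap) (simp add: case_prod_unfold)
  thus ?thesis
  proof (rule has_sum_SigmaD)
    fix z assume z: "z \<in> B"
    have "((\<lambda>i. c i z) has_sum m z) UNIV"
      using m[OF z] c[OF z] by (rule sums_nonneg_imp_has_sum)
    from has_sum_cmult_left[OF this, of "u z"]
    show "((\<lambda>y. case (z, y) of (z, i) \<Rightarrow> c i z * u z) has_sum m z * u z) UNIV" by simp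
  qed
qed

lemma has_sum_graded_imp_sums:
  fixes v :: "'b \<Rightarrow> real" and t :: real and deg :: "'b \<Rightarrow> nat"
  assumes "((\<lambda>z. v z * t ^ deg z) has_sum S) B" and fin: "\<And>n. finite {z \<in> B. deg z = n}"
  shows "(\<lambda>n. (\<Sum>z | z \<in> B \<and> deg z = n. v z) * t ^ n) sums S"
proof (rule has_sum_imp_sums)
  have "bij_betw snd (Sigma UNIV (\<lambda>n. {z \<in> B. deg z = n})) B"
    by (rule bij_betwI[where g = "\<lambda>z. (deg z, z)"]) auto
  from assms(1) have "((\<lambda>x. v (snd x) * t ^ deg (snd x)) has_sum S) (Sigma UNIV (\<lambda>n. {z \<in> B. deg z = n}))"
    by (subst has_sum_reindex_bij_betw[OF \<open>bij_betw snd _ _\<close>])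
  thus "((\<lambda>n. (\<Sum>z | z \<in> B \<and> deg z = n. v z) * t ^ n) has_sum S) UNIV"
  proof (rule has_sum_SigmaD)
    fix n
    have "((\<lambda>z. v z * t ^ deg z) has_sum (\<Sum>z | z \<in> B \<and> deg z = n. v z * t ^ deg z)) {z \<in> B. deg z = n}"
      by (rule has_sum_finite[OF fin])
    thus "((\<lambda>z. v (snd (n, z)) * t ^ deg (snd (n, z))) has_sum (\<Sum>z | z \<in> B \<and> deg z = n. v z) * t ^ n)
            {z \<in> B. deg z = n}"
      by (simp add: sum_distrib_right)
  qed
qed

text \<open>The generating functions are compared for positive t only, so the lowest coefficient is
  read off as a limit from the right. Strong induction removes the earlier coefficients and t^n is
  divided out.\<close>

lemma power_series_eq_0:
  fixes a :: "nat \<Rightarrow> real"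
  assumes \<epsilon>: "\<epsilon> > 0" and a: "\<And>t. 0 < t \<Longrightarrow> t < \<epsilon> \<Longrightarrow> (\<lambda>n. a n * t ^ n) sums 0"
  shows "a n = 0"
proof (induction n rule: less_induct)
  case (less n)
  define b where "b k = a (k + n)" for k
  have b0: "(\<lambda>k. b k * t ^ k) sums 0" if t: "0 < t" "t < \<epsilon>" for t
  proof -
    have "(\<lambda>k. a (k + n) * t ^ (k + n)) sums 0"
      using a[OF t] less by (subst sums_zero_iff_shift) auto
    hence "(\<lambda>k. a (k + n) * t ^ (k + n) / t ^ n) sums (0 / t ^ n)"
      by (rule sums_divide)
    thus ?thesis using t by (simp add: b_def power_add)
  qed
  \<comment> \<open>Convergence at the single point \<open>s\<close> gives convergence on the whole
    disc of radius \<open>s\<close>, hence continuity of \<open>f\<close> at 0.\<close>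
  define s where "s = \<epsilon> / 2"
  have s: "0 < s" "s < \<epsilon>" using \<epsilon> by (auto simp: s_def)
  define f where "f x = (\<Sum>k. b k * x ^ k)" for x
  have "(\<lambda>k. b k * x ^ k) sums f x" if "norm x < s" for x
    unfolding f_def using powser_inside[of b s x] b0[OF s] that s by (auto simp: sums_iff summable_sums)
  hence "(f \<longlongrightarrow> b 0) (at 0)"
    by (rule powser_limit_0[OF s(1)])
  hence "(f \<longlongrightarrow> b 0) (at_right 0)"
    by (rule tendsto_within_subset) auto
  moreover have "eventually (\<lambda>x. f x = 0) (at_right 0)"
    using eventually_at_right_less[of 0] eventually_at_right_real[OF \<epsilon>]
    by eventually_elim (use b0 in \<open>auto simp: f_def sums_iff\<close>)
  hence "(f \<longlongrightarrow> 0) (at_right 0)"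
    by (rule tendsto_eventually)
  ultimately have "b 0 = 0"
    using tendsto_unique[of "at_right (0::real)"] by auto
  thus ?case by (simp add: b_def)
qed

lemma power_series_unique:
  fixes a b :: "nat \<Rightarrow> real"
  assumes "\<epsilon> > 0"
    and "\<And>t. 0 < t \<Longrightarrow> t < \<epsilon> \<Longrightarrow> (\<lambda>n. a n * t ^ n) sums f t"
    and "\<And>t. 0 < t \<Longrightarrow> t < \<epsilon> \<Longrightarrow> (\<lambda>n. b n * t ^ n) sums f t"
  shows "a n = b n"
proof -
  have "a n - b n = 0"
  proof (rule power_series_eq_0[OF assms(1), where a = "\<lambda>n. a n - b n"])
    fix t :: real assume "0 < t" "t < \<epsilon>"
    from sums_diff[OF assms(2)[OF this] assms(3)[OF this]]
    show "(\<lambda>n. (a n - b n) * t ^ n) sums 0" by (simp add: left_diff_distrib)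
  qed
  thus ?thesis by simp
qed

section \<open>Truncated multiple zeta values\<close>

text \<open>
  The exponents are listed in reverse order compared with \<^const>\<open>mzv\<close>: the head of the list belongs
  to the largest summation index.
\<close>

primrec mzv_below :: "nat list \<Rightarrow> nat \<Rightarrow> real" where
  "mzv_below [] n = 1"
| "mzv_below (a # as) n = (\<Sum>k = 1..<n. mzv_below as k / real k ^ a)"

definition increasing_below :: "nat \<Rightarrow> nat \<Rightarrow> nat list set" where
  "increasing_below r n = {ks. length ks = r \<and> sorted_wrt (<) ks \<and> (\<forall>k\<in>set ks. 1 \<le> k \<and> k < n)}"

lemma mzv_below_nonneg: "mzv_below as n \<ge> 0"
  by (induction as arbitrary: n) (auto intro!: sum_nonneg divide_nonneg_nonneg)

lemma mzv_below_Suc: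
  "mzv_below (a # as) (Suc (Suc i)) = mzv_below (a # as) (Suc i) + mzv_below as (Suc i) / real (Suc i) ^ a"
  by (simp add: sum.atLeastLessThan_Suc)

lemma finite_increasing_below: "finite (increasing_below r n)"
  by (rule finite_subset[OF _ finite_lists_length_eq[of "{..<n}" r]])
     (auto simp: increasing_below_def)

lemma bij_betw_snoc_increasing_below:
  "bij_betw (\<lambda>(k, ks). ks @ [k]) (Sigma {1..<n} (increasing_below r)) (increasing_below (Suc r) n)"
  by (rule bij_betwI[where g = "\<lambda>ks. (last ks, butlast ks)"],
      auto simp: increasing_below_def sorted_wrt_append length_Suc_conv_rev butlast_append,
      meson less_trans)

lemma prod_snoc_nth:
  assumes "length ks = length \<alpha>s"
  shows "(\<Prod>i<length (\<alpha>s @ [a]). 1 / real ((ks @ [k]) ! i) ^ ((\<alpha>s @ [a]) ! i)) =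
         (\<Prod>i<length \<alpha>s. 1 / real (ks ! i) ^ (\<alpha>s ! i)) * (1 / real k ^ a)"
  using assms by (simp add: nth_append)

lemma sum_increasing_below:
  "(\<Sum>ks\<in>increasing_below (length \<alpha>s) n. \<Prod>i<length \<alpha>s. 1 / real (ks ! i) ^ (\<alpha>s ! i)) = mzv_below (rev \<alpha>s) n"
proof (induction \<alpha>s arbitrary: n rule: rev_induct)
  case Nil
  have "increasing_below 0 n = {[]}" by (auto simp: increasing_below_def)
  thus ?case by simp
next
  case (snoc a \<alpha>s)
  have "(\<Sum>ks\<in>increasing_below (length (\<alpha>s @ [a])) n. \<Prod>i<length (\<alpha>s @ [a]). 1 / real (ks ! i) ^ ((\<alpha>s @ [a]) ! i)) =
        (\<Sum>x\<in>Sigma {1..<n} (increasing_below (length \<alpha>s)).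
           \<Prod>i<length (\<alpha>s @ [a]). 1 / real ((case x of (k, ks) \<Rightarrow> ks @ [k]) ! i) ^ ((\<alpha>s @ [a]) ! i))"
    using sum.reindex_bij_betw[OF bij_betw_snoc_increasing_below[of n "length \<alpha>s"], symmetric] by simp
  also have "\<dots> = (\<Sum>(k, ks)\<in>Sigma {1..<n} (increasing_below (length \<alpha>s)).
                   (\<Prod>i<length \<alpha>s. 1 / real (ks ! i) ^ (\<alpha>s ! i)) * (1 / real k ^ a))"
  proof (intro sum.cong refl)
    fix x assume "x \<in> Sigma {1..<n} (increasing_below (length \<alpha>s))"
    then obtain k ks where x: "x = (k, ks)" "length ks = length \<alpha>s" by (auto simp: increasing_below_def)
    show "(\<Prod>i<length (\<alpha>s @ [a]). 1 / real ((case x of (k, ks) \<Rightarrow> ks @ [k]) ! i) ^ ((\<alpha>s @ [a]) ! i)) =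
          (case x of (k, ks) \<Rightarrow> (\<Prod>i<length \<alpha>s. 1 / real (ks ! i) ^ (\<alpha>s ! i)) * (1 / real k ^ a))"
      unfolding x(1) prod.case by (rule prod_snoc_nth[OF x(2)])
  qed
  also have "\<dots> = (\<Sum>k = 1..<n. \<Sum>ks\<in>increasing_below (length \<alpha>s) k.
                     (\<Prod>i<length \<alpha>s. 1 / real (ks ! i) ^ (\<alpha>s ! i)) * (1 / real k ^ a))"
    by (subst sum.Sigma) (auto simp: finite_increasing_below)
  also have "\<dots> = mzv_below (rev (\<alpha>s @ [a])) n"
    unfolding sum_distrib_right[symmetric] snoc.IH by simp
  finally show ?case .
qed

lemma sum_inverse_sqrt_le: "(\<Sum>k = 1..<Suc n. 1 / sqrt (real k)) \<le> 2 * sqrt (real n)"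
proof (induction n)
  case (Suc n)
  have "1 / sqrt (real (Suc n)) \<le> 2 * (sqrt (real (Suc n)) - sqrt (real n))"
  proof -
    define s d where "s = sqrt (real (Suc n))" and "d = s - sqrt (real n)"
    have "d \<ge> 0" "s > 0" "s + sqrt (real n) \<le> 2 * s" by (auto simp: s_def d_def)
    have "1 = d * (s + sqrt (real n))"
      by (simp add: s_def d_def algebra_simps flip: power2_eq_square)
    also have "\<dots> \<le> d * (2 * s)"
      using \<open>d \<ge> 0\<close> \<open>s + sqrt (real n) \<le> 2 * s\<close> by (rule mult_left_mono[rotated])
    finally have "1 / s \<le> 2 * d"
      using \<open>s > 0\<close> by (simp add: field_simps)
    thus ?thesis by (simp add: s_def d_def)
  qed
  thus ?case using Suc by (simp add: sum.atLeastLessThan_Suc)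
qed auto

text \<open>The true growth is at most a power of the logarithm, but a square root reproduces
  itself: dividing by k and summing 1 / sqrt k costs only a factor 2 per exponent. A final exponent
  of at least 2 then leaves the summable k^(-3/2).\<close>

lemma mzv_below_le_sqrt:
  assumes "\<forall>a\<in>set as. 1 \<le> a" "n \<ge> 1"
  shows "mzv_below as n \<le> 2 ^ length as * sqrt (real n)"
  using assms
proof (induction as arbitrary: n)
  case Nil
  thus ?case by simp
next
  case (Cons a as)
  then obtain m where m: "n = Suc m" by (cases n) auto
  have "mzv_below (a # as) n \<le> (\<Sum>k = 1..<n. 2 ^ length as * (1 / sqrt (real k)))"
    unfolding mzv_below.simps
  proof (rule sum_mono)
    fix k assume k: "k \<in> {1..<n}"
    have "mzv_below as k / real k ^ a \<le> 2 ^ length as * sqrt (real k) / real k ^ a"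
      using Cons k by (intro divide_right_mono Cons.IH) auto
    also have "\<dots> \<le> 2 ^ length as * sqrt (real k) / real k ^ 1"
      using Cons k by (intro divide_left_mono power_increasing) auto
    also have "\<dots> = 2 ^ length as * (1 / sqrt (real k))"
      using k by (simp add: field_simps)
    finally show "mzv_below as k / real k ^ a \<le> 2 ^ length as * (1 / sqrt (real k))" .
  qed
  also have "\<dots> = 2 ^ length as * (\<Sum>k = 1..<n. 1 / sqrt (real k))"
    by (simp add: sum_distrib_left)
  also have "\<dots> \<le> 2 ^ length as * (2 * sqrt (real m))"
    unfolding m by (intro mult_left_mono sum_inverse_sqrt_le) auto
  also have "\<dots> \<le> 2 ^ length (a # as) * sqrt (real n)"
    by (simp add: m)
  finally show ?case .
qed

lemma summable_mzv_below:
  assumes "\<forall>a\<in>set as. 1 \<le> a" "2 \<le> a"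
  shows "summable (\<lambda>i. mzv_below as (Suc i) / real (Suc i) ^ a)"
proof (rule summable_comparison_test'[where N = 0])
  have "summable (\<lambda>n. real n powr (- 3 / 2))"
    by (subst summable_real_powr_iff) auto
  thus "summable (\<lambda>n. 2 ^ length as * real (Suc n) powr (- 3 / 2))"
    by (intro summable_mult) (subst summable_Suc_iff)
  fix i :: nat
  define k where "k = real (Suc i)"
  have k: "k \<ge> 1" by (simp add: k_def)
  have "norm (mzv_below as (Suc i) / k ^ a) = mzv_below as (Suc i) / k ^ a"
    using mzv_below_nonneg[of as "Suc i"] k by simp
  also have "\<dots> \<le> 2 ^ length as * sqrt k / k ^ a"
    unfolding k_def using assms by (intro divide_right_mono mzv_below_le_sqrt) auto
  also have "\<dots> \<le> 2 ^ length as * sqrt k / k ^ 2"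
    using assms k by (intro divide_left_mono power_increasing) auto
  also have "\<dots> = 2 ^ length as * k powr (- 3 / 2)"
  proof -
    have "sqrt k / k ^ 2 = k powr (1 / 2) / k powr 2"
      using k by (simp add: powr_half_sqrt)
    also have "\<dots> = k powr (- 3 / 2)"
      by (simp flip: powr_diff)
    finally show ?thesis by (simp flip: times_divide_eq_right)
  qed
  finally show "norm (mzv_below as (Suc i) / real (Suc i) ^ a) \<le> 2 ^ length as * real (Suc i) powr (- 3 / 2)"
    by (simp add: k_def)
qed

text \<open>The index lists are grouped by their last entry \<open>Suc i\<close>, and the entries
  before it contribute \<open>mzv_below as (Suc i)\<close>. Nonnegativity makes the unordered sum
  equal to the iterated one.\<close>

lemma mzv_snoc_sums:
  assumes "\<forall>a\<in>set as. 1 \<le> a" "2 \<le> a"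
  shows "(\<lambda>i. mzv_below as (Suc i) / real (Suc i) ^ a) sums mzv (rev as @ [a])"
proof -
  define \<alpha>s where "\<alpha>s = rev as"
  define I where "I = {ks :: nat list. length ks = length (\<alpha>s @ [a]) \<and> sorted_wrt (<) ks \<and> (\<forall>k\<in>set ks. 1 \<le> k)}"
  define f where "f ks = (\<Prod>i<length (\<alpha>s @ [a]). 1 / real (ks ! i) ^ ((\<alpha>s @ [a]) ! i))" for ks :: "nat list"
  define g where "g = (\<lambda>(i, ks). f (ks @ [Suc i]))"
  define J where "J = Sigma (UNIV :: nat set) (\<lambda>i. increasing_below (length \<alpha>s) (Suc i))"
  have bij: "bij_betw (\<lambda>(i, ks). ks @ [Suc i]) J I"
    unfolding J_def I_def
    by (rule bij_betwI[where g = "\<lambda>ks. (last ks - 1, butlast ks)"],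
        auto simp: increasing_below_def sorted_wrt_append length_Suc_conv_rev butlast_append less_Suc_eq_le,
        fastforce)
  have inner: "((\<lambda>ks. g (i, ks)) has_sum mzv_below as (Suc i) / real (Suc i) ^ a)
                 (increasing_below (length \<alpha>s) (Suc i))" for i
  proof -
    have "((\<lambda>ks. g (i, ks)) has_sum (\<Sum>ks\<in>increasing_below (length \<alpha>s) (Suc i). g (i, ks)))
            (increasing_below (length \<alpha>s) (Suc i))"
      by (rule has_sum_finite[OF finite_increasing_below])
    also have "(\<Sum>ks\<in>increasing_below (length \<alpha>s) (Suc i). g (i, ks)) =
               (\<Sum>ks\<in>increasing_below (length \<alpha>s) (Suc i). (\<Prod>i<length \<alpha>s. 1 / real (ks ! i) ^ (\<alpha>s ! i)) * (1 / real (Suc i) ^ a))"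
      unfolding g_def f_def prod.case
      by (intro sum.cong refl prod_snoc_nth) (auto simp: increasing_below_def)
    also have "\<dots> = mzv_below as (Suc i) / real (Suc i) ^ a"
      unfolding sum_distrib_right[symmetric] sum_increasing_below by (simp add: \<alpha>s_def)
    finally show ?thesis .
  qed
  have sums: "((\<lambda>i. mzv_below as (Suc i) / real (Suc i) ^ a) has_sum
                 (\<Sum>i. mzv_below as (Suc i) / real (Suc i) ^ a)) UNIV"
    by (intro sums_nonneg_imp_has_sum summable_sums summable_mzv_below assms divide_nonneg_nonneg
              mzv_below_nonneg) auto
  have "(g has_sum (\<Sum>i. mzv_below as (Suc i) / real (Suc i) ^ a)) J"
    unfolding J_def
  proof (rule has_sum_SigmaI[OF inner sums], rule summable_on_SigmaI[OF inner])
    show "(\<lambda>i. mzv_below as (Suc i) / real (Suc i) ^ a) summable_on UNIV"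
      using sums by (rule has_sum_imp_summable)
    have "f ks \<ge> 0" for ks
      unfolding f_def by (intro prod_nonneg) auto
    thus "g (i, ks) \<ge> 0" for i ks
      by (simp add: g_def)
  qed
  hence "((\<lambda>x. f ((\<lambda>(i, ks). ks @ [Suc i]) x)) has_sum (\<Sum>i. mzv_below as (Suc i) / real (Suc i) ^ a)) J"
    by (simp add: g_def case_prod_unfold)
  hence "(f has_sum (\<Sum>i. mzv_below as (Suc i) / real (Suc i) ^ a)) I"
    by (subst (asm) has_sum_reindex_bij_betw[OF bij])
  hence "mzv (\<alpha>s @ [a]) = (\<Sum>i. mzv_below as (Suc i) / real (Suc i) ^ a)"
    unfolding mzv_def by (fold I_def f_def) (rule infsumI)
  thus ?thesis
    using summable_sums[OF summable_mzv_below[OF assms]] by (simp add: \<alpha>s_def)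
qed

section \<open>Generating functions of multiple zeta values\<close>

lemma geometric_has_sum:
  fixes y k :: real
  assumes "\<bar>y\<bar> < k"
  shows "((\<lambda>b. y ^ b / k ^ (b + 2)) has_sum (1 / (k * (k - y)))) UNIV"
proof -
  have k: "k > 0" "k - y > 0" using assms by auto
  have "norm (y / k) < 1" using assms k by simp
  from geometric_sums[OF this] and summable_geometric[of "norm (y / k)"] and this
  have "((\<lambda>b. (y / k) ^ b) has_sum (1 / (1 - y / k))) UNIV"
    by (intro norm_summable_imp_has_sum) (auto simp: norm_power power_abs)
  from has_sum_cmult_right[OF this, of "1 / k\<^sup>2"] show ?thesis
    using k by (simp add: power_divide power_add field_simps power2_eq_square)
qed

text \<open>The coefficients are the elementary symmetric functions of 1, 1/2, ..., 1/i, so their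
  generating function is the product of 1 + x/j over j \<le> i.\<close>

lemma mzv_below_ones_sums:
  "(\<lambda>a. mzv_below (replicate a 1) (Suc i) * x ^ a) sums (pochhammer (1 + x) i / fact i)"
proof (induction i)
  case 0
  have "(\<lambda>a. mzv_below (replicate a 1) (Suc 0) * x ^ a) = (\<lambda>a. if a = 0 then 1 else 0)"
    by (rule ext, case_tac a) auto
  thus ?case using sums_single[of 0 "\<lambda>_. 1 :: real"] by simp
next
  case (Suc i)
  define f where "f a = mzv_below (replicate a 1) (Suc i) * x ^ a" for a
  define g where "g a = mzv_below (replicate a 1) (Suc (Suc i)) * x ^ a" for a
  define P where "P = pochhammer (1 + x) i / fact i"
  have f: "f sums P" using Suc by (simp add: f_def[abs_def] P_def)
  have "(\<lambda>a. f (Suc a)) sums (P - f 0)"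
    using f by (subst sums_Suc_iff) simp
  hence "(\<lambda>a. f (Suc a) + x / real (Suc i) * f a) sums (P - f 0 + x / real (Suc i) * P)"
    by (intro sums_add sums_mult f)
  also have "(\<lambda>a. f (Suc a) + x / real (Suc i) * f a) = (\<lambda>a. g (Suc a))"
    unfolding f_def g_def replicate_Suc mzv_below_Suc by (simp add: fun_eq_iff algebra_simps del: mzv_below.simps(2))
  finally have "g sums (P - f 0 + x / real (Suc i) * P + g 0)"
    by (subst (asm) sums_Suc_iff)
  also have "P - f 0 + x / real (Suc i) * P + g 0 = P * ((1 + x + real i) / real (Suc i))"
    by (simp add: f_def g_def field_simps)
  also have "\<dots> = pochhammer (1 + x) (Suc i) / fact (Suc i)"
    by (simp add: P_def pochhammer_Suc)
  finally show ?case by (simp add: g_def[abs_def])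
qed

lemma gauss_series_summable:
  fixes x y :: real
  assumes "0 < x" "x < 1" "\<bar>y\<bar> < 1" "y \<noteq> 0"
  shows "summable (\<lambda>i. pochhammer (1 + x) i / fact i / (real (Suc i) * (real (Suc i) - y)))"
  using sums_summable[OF sums_divide[OF gauss_series_Beta[OF assms], of "x * y"]] assms by simp

text \<open>For fixed largest index k the ones contribute the product of 1 + x/j over j < k, and the
  last exponent contributes the geometric sum 1 / (k (k - y)). The majorant is the same series with
  |y| in place of y.\<close>

lemma mzv_ones_has_sum:
  fixes x y :: real
  assumes x: "0 < x" "x < 1" and y: "\<bar>y\<bar> < 1" "y \<noteq> 0"
  shows "((\<lambda>(a, b). mzv (replicate a 1 @ [b + 2]) * (x ^ a * y ^ b)) has_sum
           (\<Sum>i. pochhammer (1 + x) i / fact i / (real (Suc i) * (real (Suc i) - y)))) UNIV"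
proof -
  define c where "c i z = (case z of (a, b) \<Rightarrow> mzv_below (replicate a 1) (Suc i) / real (Suc i) ^ (b + 2))"
    for i :: nat and z :: "nat \<times> nat"
  have has_sum: "((\<lambda>z. c i z * (case z of (a, b) \<Rightarrow> x ^ a * u ^ b)) has_sum
                   (pochhammer (1 + x) i / fact i / (real (Suc i) * (real (Suc i) - u)))) UNIV"
    if u: "\<bar>u\<bar> < 1" for u i
  proof -
    have "((\<lambda>a. mzv_below (replicate a 1) (Suc i) * x ^ a) has_sum (pochhammer (1 + x) i / fact i)) UNIV"
      using x by (intro sums_nonneg_imp_has_sum mzv_below_ones_sums) (auto intro!: mult_nonneg_nonneg mzv_below_nonneg)
    moreover have "((\<lambda>b. u ^ b / real (Suc i) ^ (b + 2)) has_sum (1 / (real (Suc i) * (real (Suc i) - u)))) UNIV"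
      using u by (intro geometric_has_sum) auto
    ultimately have "((\<lambda>(a, b). mzv_below (replicate a 1) (Suc i) * x ^ a * (u ^ b / real (Suc i) ^ (b + 2))) has_sum
        (pochhammer (1 + x) i / fact i * (1 / (real (Suc i) * (real (Suc i) - u))))) (UNIV \<times> UNIV)"
      by (rule has_sum_product_real)
    thus ?thesis by (simp add: c_def case_prod_unfold mult_ac)
  qed
  have abs: "\<bar>case z of (a, b) \<Rightarrow> x ^ a * y ^ b\<bar> = (case z of (a, b) \<Rightarrow> x ^ a * \<bar>y\<bar> ^ b)" for z :: "nat \<times> nat"
    using x by (simp add: case_prod_unfold abs_mult power_abs)
  have "((\<lambda>z. (case z of (a, b) \<Rightarrow> mzv (replicate a 1 @ [b + 2])) * (case z of (a, b) \<Rightarrow> x ^ a * y ^ b)) has_sum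
           (\<Sum>i. pochhammer (1 + x) i / fact i / (real (Suc i) * (real (Suc i) - y)))) UNIV"
  proof (rule has_sum_exchange_weighted)
    show "c i z \<ge> 0" for i z
      by (auto simp: c_def mzv_below_nonneg split: prod.splits)
    show "((\<lambda>z. c i z * \<bar>case z of (a, b) \<Rightarrow> x ^ a * y ^ b\<bar>) has_sum
             (pochhammer (1 + x) i / fact i / (real (Suc i) * (real (Suc i) - \<bar>y\<bar>)))) UNIV" for i
      unfolding abs using y by (intro has_sum) auto
    show "((\<lambda>z. c i z * (case z of (a, b) \<Rightarrow> x ^ a * y ^ b)) has_sum
             (pochhammer (1 + x) i / fact i / (real (Suc i) * (real (Suc i) - y)))) UNIV" for i
      using y by (intro has_sum) auto
    show "summable (\<lambda>i. pochhammer (1 + x) i / fact i / (real (Suc i) * (real (Suc i) - \<bar>y\<bar>)))"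
      using x y by (intro gauss_series_summable) auto
    show "(\<lambda>i. pochhammer (1 + x) i / fact i / (real (Suc i) * (real (Suc i) - y))) sums
          (\<Sum>i. pochhammer (1 + x) i / fact i / (real (Suc i) * (real (Suc i) - y)))"
      using x y by (intro summable_sums gauss_series_summable) auto
    fix z :: "nat \<times> nat"
    obtain a b where z: "z = (a, b)" by (cases z)
    have "(\<lambda>i. mzv_below (replicate a 1) (Suc i) / real (Suc i) ^ (b + 2)) sums mzv (rev (replicate a 1) @ [b + 2])"
      by (rule mzv_snoc_sums) auto
    thus "(\<lambda>i. c i z) sums (case z of (a, b) \<Rightarrow> mzv (replicate a 1 @ [b + 2]))"
      by (simp add: z c_def)
  qed
  thus ?thesis by (simp add: case_prod_unfold)
qed

lemma finite_pairs_sum_eq: "finite {z :: nat \<times> nat. fst z + snd z = n}"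
  by (rule finite_subset[of _ "{..n} \<times> {..n}"]) auto

lemma mzv_ones_graded_sums:
  fixes t \<epsilon> :: real
  assumes t: "0 < t" "t < 1" and \<epsilon>: "\<bar>\<epsilon>\<bar> = 1"
  shows "(\<lambda>n. (\<Sum>(a, b)\<in>{(a, b). a + b = n}. \<epsilon> ^ b * mzv (replicate a 1 @ [b + 2])) * t ^ n) sums
           (\<Sum>i. pochhammer (1 + t) i / fact i / (real (Suc i) * (real (Suc i) - \<epsilon> * t)))"
proof -
  have "\<bar>\<epsilon> * t\<bar> < 1" "\<epsilon> * t \<noteq> 0" using t \<epsilon> by (auto simp: abs_mult)
  from mzv_ones_has_sum[OF t this]
  have "((\<lambda>z. (case z of (a, b) \<Rightarrow> \<epsilon> ^ b * mzv (replicate a 1 @ [b + 2])) * t ^ (fst z + snd z)) has_sum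
         (\<Sum>i. pochhammer (1 + t) i / fact i / (real (Suc i) * (real (Suc i) - \<epsilon> * t)))) UNIV"
    by (simp add: case_prod_unfold power_mult_distrib power_add mult_ac)
  from has_sum_graded_imp_sums[OF this]
  show ?thesis by (simp add: finite_pairs_sum_eq case_prod_unfold)
qed

lemma Z_plus_sums:
  assumes "0 < t" "t < 1"
  shows "(\<lambda>n. Z_plus n * t ^ n) sums
           (\<Sum>i. pochhammer (1 + t) i / fact i / (real (Suc i) * (real (Suc i) - t)))"
  using mzv_ones_graded_sums[OF assms, of 1] by (simp add: Z_plus_def)

lemma Z_minus_sums:
  assumes "0 < t" "t < 1"
  shows "(\<lambda>n. Z_minus n * t ^ n) sums
           (\<Sum>i. pochhammer (1 + t) i / fact i / (real (Suc i) * (real (Suc i) + t)))"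
  using mzv_ones_graded_sums[OF assms, of "- 1"] by (simp add: Z_minus_def)

section \<open>Duality, and the vanishing of \<open>Z_minus\<close> at odd arguments\<close>

lemma gauss_series_commute:
  fixes x y :: real
  assumes x: "0 < x" "x < 1" and y: "0 < y" "y < 1"
  shows "(\<Sum>i. pochhammer (1 + x) i / fact i / (real (Suc i) * (real (Suc i) - y))) =
         (\<Sum>i. pochhammer (1 + y) i / fact i / (real (Suc i) * (real (Suc i) - x)))"
proof -
  have eq: "(\<Sum>i. pochhammer (1 + x) i / fact i / (real (Suc i) * (real (Suc i) - y))) =
            (1 - (1 - x - y) * Beta (1 - y) (1 - x)) / (x * y)"
    if "0 < x" "x < 1" "0 < y" "y < 1" for x y :: real
    using sums_unique[OF sums_divide[OF gauss_series_Beta[of x y], of "x * y"]] that by simp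
  show ?thesis
    using x y by (simp only: eq Beta_commute[of "1 - x"] mult.commute[of y] diff_diff_eq add.commute[of y])
qed

text \<open>\<open>F x y\<close> is symmetric, so \<open>M a b\<close> and \<open>M b a\<close> have
  the same double generating function. It is available only for positive x and y, and coefficients
  are extracted one variable at a time: in x for fixed y, then in y.\<close>

lemma mzv_ones_duality:
  "mzv (replicate a 1 @ [b + 2]) = mzv (replicate b 1 @ [a + 2])"
proof -
  define M where "M a b = mzv (replicate a 1 @ [b + 2])" for a b
  define F where "F x y = (\<Sum>i. pochhammer (1 + x) i / fact i / (real (Suc i) * (real (Suc i) - y)))" for x y :: real
  have M: "((\<lambda>(a, b). M a b * (x ^ a * y ^ b)) has_sum F x y) (UNIV \<times> UNIV)"
    if "0 < x" "x < 1" "0 < y" "y < 1" for x y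
    using mzv_ones_has_sum[of x y] that by (simp add: M_def F_def)
  have M': "((\<lambda>(a, b). M b a * (x ^ a * y ^ b)) has_sum F x y) (UNIV \<times> UNIV)"
    if "0 < x" "x < 1" "0 < y" "y < 1" for x y
  proof -
    have "((\<lambda>(a, b). M a b * (y ^ a * x ^ b)) has_sum F x y) (UNIV \<times> UNIV)"
      using M[of y x] gauss_series_commute[of x y] that by (simp add: F_def)
    thus ?thesis by (subst has_sum_swap) (simp add: mult_ac)
  qed
  have inner: "summable (\<lambda>b. N a b * y ^ b) \<and> (\<lambda>a. (\<Sum>b. N a b * y ^ b) * x ^ a) sums F x y"
    if xy: "0 < x" "x < 1" and N: "((\<lambda>(a, b). N a b * (x ^ a * y ^ b)) has_sum F x y) (UNIV \<times> UNIV)"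
    for x y :: real and N a
  proof -
    have *: "((\<lambda>b. N a b * y ^ b) has_sum (\<Sum>b. N a b * y ^ b)) UNIV" for a
    proof -
      have "(\<lambda>b. N a b * (x ^ a * y ^ b)) summable_on UNIV"
        using summable_on_SigmaD1[OF has_sum_imp_summable[OF N], of a] by simp
      hence "(\<lambda>b. N a b * (x ^ a * y ^ b) * (1 / x ^ a)) summable_on UNIV"
        by (rule summable_on_cmult_left)
      hence "(\<lambda>b. N a b * y ^ b) summable_on UNIV"
        using xy by simp
      thus ?thesis
        using has_sum_infsum has_sum_imp_sums sums_unique by metis
    qed
    have "((\<lambda>a. (\<Sum>b. N a b * y ^ b) * x ^ a) has_sum F x y) UNIV"
    proof (rule has_sum_SigmaD[OF N])
      fix a
      show "((\<lambda>b. case (a, b) of (a, b) \<Rightarrow> N a b * (x ^ a * y ^ b)) has_sum (\<Sum>b. N a b * y ^ b) * x ^ a) UNIV"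
        using has_sum_cmult_left[OF *[of a], of "x ^ a"] by (simp add: mult_ac)
    qed
    thus ?thesis
      using has_sum_imp_sums has_sum_imp_sums[OF *[of a]] sums_summable by blast
  qed
  have "(\<Sum>b. M a b * y ^ b) = (\<Sum>b. M b a * y ^ b)" if y: "0 < y" "y < 1" for y a
  proof (rule power_series_unique[where \<epsilon> = 1 and f = "\<lambda>x. F x y"])
    fix x :: real assume x: "0 < x" "x < 1"
    show "(\<lambda>a. (\<Sum>b. M a b * y ^ b) * x ^ a) sums F x y"
      using inner[OF x M[OF x y]] by blast
    show "(\<lambda>a. (\<Sum>b. M b a * y ^ b) * x ^ a) sums F x y"
      using inner[OF x M'[OF x y]] by blast
  qed simp
  hence "M a b = M b a"
  proof (intro power_series_unique[where \<epsilon> = 1 and f = "\<lambda>y. \<Sum>b. M a b * y ^ b" and a = "\<lambda>b. M a b" and b = "\<lambda>b. M b a"])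
    assume *: "\<And>y a. 0 < y \<Longrightarrow> y < 1 \<Longrightarrow> (\<Sum>b. M a b * y ^ b) = (\<Sum>b. M b a * y ^ b)"
    fix y :: real assume y: "0 < y" "y < 1"
    \<comment> \<open>Any x in (0, 1) would do: it serves only to obtain summability of the inner
      series in y.\<close>
    have x: "0 < (1 / 2 :: real)" "1 / 2 < (1 :: real)" by auto
    show "(\<lambda>b. M a b * y ^ b) sums (\<Sum>b. M a b * y ^ b)"
      using inner[OF x M[OF x y], of a] by (auto intro: summable_sums)
    show "(\<lambda>b. M b a * y ^ b) sums (\<Sum>b. M a b * y ^ b)"
      using inner[OF x M'[OF x y], of a] *[OF y] by (auto intro: summable_sums)
  qed simp
  thus ?thesis by (simp add: M_def)
qed

lemma Z_minus_odd:
  assumes "odd n"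
  shows "Z_minus n = 0"
proof -
  have "Z_minus n = (\<Sum>(a, b)\<in>{(a, b). a + b = n}. (-1) ^ a * mzv (replicate b 1 @ [a + 2]))"
    unfolding Z_minus_def by (rule sum.reindex_bij_witness[of _ prod.swap prod.swap]) auto
  also have "\<dots> = (\<Sum>(a, b)\<in>{(a, b). a + b = n}. - ((-1) ^ b * mzv (replicate a 1 @ [b + 2])))"
  proof (intro sum.cong refl, clarify)
    fix a b assume "n = a + b"
    have "(-1 :: real) ^ a = - ((-1) ^ b)"
      using assms \<open>n = a + b\<close> by (auto simp: minus_one_power_iff)
    thus "(-1) ^ a * mzv (replicate b 1 @ [a + 2]) = - ((-1) ^ b * mzv (replicate a 1 @ [b + 2]))"
      using mzv_ones_duality[of a b] by simp
  qed
  also have "\<dots> = - Z_minus n"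
    by (simp add: Z_minus_def case_prod_unfold sum_negf)
  finally show ?thesis by simp
qed

section \<open>The generating function of the left-hand sides\<close>

text \<open>Raising the bound to admit the index k = i + 1 leaves a list as it was or puts one
  exponent a \<ge> 1 in front, belonging to k. This multiplies the sum by 1 + \<epsilon> (t/k +
  (t/k)^2 + ...) = 1 + \<epsilon> t / (k - t).\<close>

lemma mzv_below_lists_has_sum:
  fixes t \<epsilon> :: real
  assumes t: "0 < t" "t < 1"
  shows "((\<lambda>as. \<epsilon> ^ length as * (mzv_below as (Suc i) * t ^ sum_list as)) has_sum
           (\<Prod>j<i. 1 + \<epsilon> * (t / (real (Suc j) - t)))) {as. \<forall>a\<in>set as. 1 \<le> a}"
proof (induction i)
  case 0
  have "mzv_below as (Suc 0) = 0" if "as \<noteq> []" for as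
    using that by (cases as) auto
  hence "((\<lambda>as. \<epsilon> ^ length as * (mzv_below as (Suc 0) * t ^ sum_list as)) has_sum 1) {as. \<forall>a\<in>set as. 1 \<le> a} \<longleftrightarrow>
         ((\<lambda>_. 1 :: real) has_sum 1) {[] :: nat list}"
    by (intro has_sum_cong_neutral) auto
  thus ?case using has_sum_finite[of "{[] :: nat list}" "\<lambda>_. 1 :: real"] by simp
next
  case (Suc i)
  define L where "L = {as :: nat list. \<forall>a\<in>set as. 1 \<le> a}"
  define k where "k = real (Suc i)"
  have k: "k > t" using t by (simp add: k_def)
  define P where "P = (\<Prod>j<i. 1 + \<epsilon> * (t / (real (Suc j) - t)))"
  define f where "f as = \<epsilon> ^ length as * (mzv_below as (Suc i) * t ^ sum_list as)" for as
  define h where "h as = (case as of [] \<Rightarrow> 0 | a # as' \<Rightarrow> \<epsilon> * (t / k) ^ a * f as')" for as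
  have f: "(f has_sum P) L"
    using Suc by (simp add: f_def[abs_def] P_def L_def)
  have geo: "((\<lambda>a. (t / k) ^ a) has_sum (t / k / (1 - t / k))) {1..}"
    using t k by (intro has_sum_geometric_from_1) auto
  have geo': "t / k / (1 - t / k) = t / (k - t)"
    using t k by (simp add: field_simps)
  have "((\<lambda>a. \<epsilon> * (t / k) ^ a) has_sum (\<epsilon> * (t / (k - t)))) {1..}"
    using has_sum_cmult_right[OF geo, of \<epsilon>] by (simp only: geo')
  from has_sum_product_real[OF this f]
  have "((\<lambda>z. h (case z of (a, as) \<Rightarrow> a # as)) has_sum (\<epsilon> * (t / (k - t)) * P)) ({1..} \<times> L)"
    by (simp add: h_def case_prod_unfold)
  moreover have "bij_betw (\<lambda>(a, as). a # as) ({1..} \<times> L) (L - {[]})"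
    by (rule bij_betwI[where g = "\<lambda>as. (hd as, tl as)"]) (auto simp: L_def neq_Nil_conv)
  ultimately have "(h has_sum (\<epsilon> * (t / (k - t)) * P)) (L - {[]})"
    by (subst (asm) has_sum_reindex_bij_betw)
  also have "?this \<longleftrightarrow> (h has_sum (\<epsilon> * (t / (k - t)) * P)) L"
    by (intro has_sum_cong_neutral) (auto simp: h_def)
  finally have "((\<lambda>as. f as + h as) has_sum (P + \<epsilon> * (t / (k - t)) * P)) L"
    by (intro has_sum_add f)
  also have "(\<lambda>as. f as + h as) = (\<lambda>as. \<epsilon> ^ length as * (mzv_below as (Suc (Suc i)) * t ^ sum_list as))"
  proof
    fix as
    show "f as + h as = \<epsilon> ^ length as * (mzv_below as (Suc (Suc i)) * t ^ sum_list as)"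
    proof (cases as)
      case (Cons a as')
      have "h as = \<epsilon> ^ length as * (mzv_below as' (Suc i) / real (Suc i) ^ a * t ^ sum_list as)"
        by (simp add: Cons h_def f_def k_def power_divide power_add)
      thus ?thesis
        unfolding Cons mzv_below_Suc f_def distrib_right distrib_left by simp
    qed (simp add: f_def h_def)
  qed
  also have "P + \<epsilon> * (t / (k - t)) * P = (\<Prod>j<Suc i. 1 + \<epsilon> * (t / (real (Suc j) - t)))"
    by (simp add: P_def k_def algebra_simps)
  finally show ?case by (simp add: L_def)
qed

lemma prod_eq_pochhammer_ratio:
  fixes t c :: real
  assumes "t < 1"
  shows "(\<Prod>j<i. 1 + c * (t / (real (Suc j) - t))) = pochhammer (1 - t + c * t) i / pochhammer (1 - t) i"
proof -
  have "(\<Prod>j<i. 1 + c * (t / (real (Suc j) - t))) = (\<Prod>j<i. (1 - t + c * t + real j) / (1 - t + real j))"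
  proof (intro prod.cong refl)
    fix j
    have "1 - t + real j > 0" using assms by linarith
    moreover have "real (Suc j) - t = 1 - t + real j" by simp
    ultimately show "1 + c * (t / (real (Suc j) - t)) = (1 - t + c * t + real j) / (1 - t + real j)"
      by (simp add: field_simps)
  qed
  thus ?thesis
    by (simp add: pochhammer_prod prod_dividef atLeast0LessThan)
qed

text \<open>Half the difference of the cases \<epsilon> = 1 and \<epsilon> = -1. Odd length is the
  parity wanted: for even m there are m + 1 exponents besides the last.\<close>

lemma mzv_below_odd_lists_has_sum:
  fixes t :: real
  assumes t: "0 < t" "t < 1"
  shows "((\<lambda>as. mzv_below as (Suc i) * t ^ sum_list as) has_sum
           ((fact i / pochhammer (1 - t) i - pochhammer (1 - 2 * t) i / pochhammer (1 - t) i) / 2))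
         {as. (\<forall>a\<in>set as. 1 \<le> a) \<and> odd (length as)}"
proof -
  define L where "L = {as :: nat list. \<forall>a\<in>set as. 1 \<le> a}"
  define f where "f as = mzv_below as (Suc i) * t ^ sum_list as" for as
  have 1: "(f has_sum (fact i / pochhammer (1 - t) i)) L"
    using mzv_below_lists_has_sum[OF t, of 1 i] prod_eq_pochhammer_ratio[of t 1 i] t
    by (simp add: f_def[abs_def] L_def flip: pochhammer_fact)
  have 2: "((\<lambda>as. (-1) ^ length as * f as) has_sum (pochhammer (1 - 2 * t) i / pochhammer (1 - t) i)) L"
    using mzv_below_lists_has_sum[OF t, of "-1" i] prod_eq_pochhammer_ratio[of t "-1" i] t
    by (simp add: f_def[abs_def] L_def)
  have "((\<lambda>as. 1 / 2 * (f as - (-1) ^ length as * f as)) has_sum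
          (1 / 2 * (fact i / pochhammer (1 - t) i - pochhammer (1 - 2 * t) i / pochhammer (1 - t) i))) L"
    using has_sum_add[OF has_sum_cmult_right[OF 1, of "1 / 2"] has_sum_cmult_right[OF 2, of "- 1 / 2"]]
    by (simp add: diff_divide_distrib mult_ac)
  also have "?this \<longleftrightarrow> (f has_sum
          (1 / 2 * (fact i / pochhammer (1 - t) i - pochhammer (1 - 2 * t) i / pochhammer (1 - t) i)))
           {as. (\<forall>a\<in>set as. 1 \<le> a) \<and> odd (length as)}"
    by (intro has_sum_cong_neutral) (auto simp: L_def)
  finally show ?thesis by (simp add: f_def[abs_def])
qed

text \<open>
  A pair (b, as) stands for the composition \<^term>\<open>rev as @ [b]\<close>.
\<close>

definition odd_tail_index :: "(nat \<times> nat list) set" where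
  "odd_tail_index = {1..} \<times> {as. (\<forall>a\<in>set as. 1 \<le> a) \<and> odd (length as)}"

lemma odd_tail_mzv_has_sum:
  fixes t S :: real
  assumes t: "0 < t" "t < 1 / 2"
    and S: "(\<lambda>i. 2 / (real (Suc i) * (real (Suc i) - 2 * t)) *
              (fact i / pochhammer (1 - t) i - pochhammer (1 - 2 * t) i / pochhammer (1 - t) i)) sums S"
  shows "((\<lambda>(b, as). 2 ^ (b + 1) * mzv (rev as @ [b + 1]) * t ^ (b - 1 + sum_list as)) has_sum S) odd_tail_index"
proof -
  define L where "L = {as :: nat list. (\<forall>a\<in>set as. 1 \<le> a) \<and> odd (length as)}"
  define H where "H i = 2 / (real (Suc i) * (real (Suc i) - 2 * t)) *
              (fact i / pochhammer (1 - t) i - pochhammer (1 - 2 * t) i / pochhammer (1 - t) i)" for i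
  define c where "c i z = (case z of (b, as) \<Rightarrow> mzv_below as (Suc i) / real (Suc i) ^ (b + 1))"
    for i :: nat and z :: "nat \<times> nat list"
  define u where "u z = (case z of (b, as) \<Rightarrow> 2 ^ (b + 1) * t ^ (b - 1 + sum_list as))" for z :: "nat \<times> nat list"
  have u: "u z \<ge> 0" for z using t by (auto simp: u_def split: prod.splits)
  have H: "((\<lambda>z. c i z * u z) has_sum H i) ({1..} \<times> L)" for i
  proof -
    define k where "k = real (Suc i)"
    have k: "k > 0" "k - 2 * t > 0" using t by (auto simp: k_def)
    have "((\<lambda>b. (2 * t) ^ b / k ^ (b + 2)) has_sum (1 / (k * (k - 2 * t)))) UNIV"
      using t k by (intro geometric_has_sum) auto
    \<comment> \<open>The 4 arises because the last part starts at 1: 2^(b + 1) t^(b - 1) = 4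
      (2t)^(b - 1). The half from the parity selection reduces it to the 2 in
      \<open>H\<close>.\<close>
    hence "((\<lambda>b. 4 * ((2 * t) ^ b / k ^ (b + 2))) has_sum (4 * (1 / (k * (k - 2 * t))))) UNIV"
      by (rule has_sum_cmult_right)
    also have "?this \<longleftrightarrow> ((\<lambda>b. 2 ^ (b + 1) * t ^ (b - 1) / k ^ (b + 1)) has_sum (4 * (1 / (k * (k - 2 * t))))) {1..}"
      by (rule has_sum_reindex_bij_witness[of _ "\<lambda>b. b - 1" Suc]) (auto simp: power_mult_distrib)
    finally have 1: "((\<lambda>b. 2 ^ (b + 1) * t ^ (b - 1) / k ^ (b + 1)) has_sum (4 * (1 / (k * (k - 2 * t))))) {1..}" .
    have "((\<lambda>as. mzv_below as (Suc i) * t ^ sum_list as) has_sum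
           ((fact i / pochhammer (1 - t) i - pochhammer (1 - 2 * t) i / pochhammer (1 - t) i) / 2)) L"
      unfolding L_def using t by (intro mzv_below_odd_lists_has_sum) auto
    note 2 = this
    have "4 * (1 / (k * (k - 2 * t))) *
            ((fact i / pochhammer (1 - t) i - pochhammer (1 - 2 * t) i / pochhammer (1 - t) i) / 2) = H i"
    proof -
      have "4 * (1 / x) * (d / 2) = 2 / x * d" for x d :: real by simp
      thus ?thesis unfolding H_def k_def[symmetric] .
    qed
    with has_sum_product_real[OF 1 2]
    have "((\<lambda>(b, as). 2 ^ (b + 1) * t ^ (b - 1) / k ^ (b + 1) * (mzv_below as (Suc i) * t ^ sum_list as)) has_sum H i)
            ({1..} \<times> L)"
      by (simp only:)
    thus ?thesis
      by (simp add: c_def u_def k_def case_prod_unfold power_add mult_ac)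
  qed
  have "((\<lambda>z. (case z of (b, as) \<Rightarrow> mzv (rev as @ [b + 1])) * u z) has_sum S) ({1..} \<times> L)"
  proof (rule has_sum_exchange_weighted[where c = c and G = H and H = H])
    show "c i z \<ge> 0" for i z
      by (auto simp: c_def mzv_below_nonneg split: prod.splits)
    show "((\<lambda>z. c i z * \<bar>u z\<bar>) has_sum H i) ({1..} \<times> L)" for i
      using H[of i] u by simp
    show "((\<lambda>z. c i z * u z) has_sum H i) ({1..} \<times> L)" for i
      by (rule H)
    show "H sums S" using S by (simp add: H_def[abs_def])
    thus "summable H" by (simp add: sums_iff)
    fix z :: "nat \<times> nat list" assume "z \<in> {1..} \<times> L"
    then obtain b as where z: "z = (b, as)" "b \<ge> 1" "\<forall>a\<in>set as. 1 \<le> a" by (auto simp: L_def)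
    have "(\<lambda>i. mzv_below as (Suc i) / real (Suc i) ^ (b + 1)) sums mzv (rev as @ [b + 1])"
      using z by (intro mzv_snoc_sums) auto
    thus "(\<lambda>i. c i z) sums (case z of (b, as) \<Rightarrow> mzv (rev as @ [b + 1]))"
      by (simp add: z(1) c_def)
  qed
  thus ?thesis
    by (simp add: odd_tail_index_def L_def u_def case_prod_unfold mult_ac)
qed

lemma length_le_sum_list:
  fixes as :: "nat list"
  assumes "\<forall>a\<in>set as. 1 \<le> a"
  shows "length as \<le> sum_list as"
  using assms by (induction as) auto

lemma finite_odd_tail_index: "finite {z \<in> odd_tail_index. fst z - 1 + sum_list (snd z) = n}"
proof (rule finite_subset)
  show "{z \<in> odd_tail_index. fst z - 1 + sum_list (snd z) = n} \<subseteq>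
          {..n + 1} \<times> {as. set as \<subseteq> {..n} \<and> length as \<le> n}"
  proof
    fix z assume "z \<in> {z \<in> odd_tail_index. fst z - 1 + sum_list (snd z) = n}"
    then obtain b as where z: "z = (b, as)" "\<forall>a\<in>set as. 1 \<le> a" "b - 1 + sum_list as = n"
      by (auto simp: odd_tail_index_def)
    have "x \<le> n" if "x \<in> set as" for x
      using member_le_sum_list[OF that] z(3) by simp
    thus "z \<in> {..n + 1} \<times> {as. set as \<subseteq> {..n} \<and> length as \<le> n}"
      using z length_le_sum_list[OF z(2)] by auto
  qed
  show "finite ({..n + 1} \<times> {as :: nat list. set as \<subseteq> {..n} \<and> length as \<le> n})"
    by (intro finite_cartesian_product finite_lists_length_le) auto
qed

text \<open>A composition of p + 3 into m + 2 positive parts exists only for m \<le> p + 1, so this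
  bound on m matches the unrestricted odd lengths on the right. The degree is p + 2 because t
  carries b - 1 for the last part b.\<close>

lemma sum_compositions_eq:
  "(\<Sum>m | m \<le> p + 1 \<and> even m. \<Sum>\<alpha>s\<in>compositions (m + 2) (p + 3).
      2 ^ (\<alpha>s ! (m + 1) + 1) * mzv (take (m + 1) \<alpha>s @ [\<alpha>s ! (m + 1) + 1])) =
   (\<Sum>z | z \<in> odd_tail_index \<and> fst z - 1 + sum_list (snd z) = p + 2.
      2 ^ (fst z + 1) * mzv (rev (snd z) @ [fst z + 1]))"
proof -
  have fin: "finite (compositions r n)" for r n
  proof (rule finite_subset)
    show "compositions r n \<subseteq> {as. set as \<subseteq> {..n} \<and> length as = r}"
      by (auto simp: compositions_def member_le_sum_list)
  qed (simp add: finite_lists_length_eq)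
  have "(\<Sum>m | m \<le> p + 1 \<and> even m. \<Sum>\<alpha>s\<in>compositions (m + 2) (p + 3).
      2 ^ (\<alpha>s ! (m + 1) + 1) * mzv (take (m + 1) \<alpha>s @ [\<alpha>s ! (m + 1) + 1])) =
      (\<Sum>(m, \<alpha>s)\<in>(SIGMA m:{m. m \<le> p + 1 \<and> even m}. compositions (m + 2) (p + 3)).
      2 ^ (\<alpha>s ! (m + 1) + 1) * mzv (take (m + 1) \<alpha>s @ [\<alpha>s ! (m + 1) + 1]))"
    by (subst sum.Sigma) (auto simp: fin)
  also have "\<dots> = (\<Sum>z | z \<in> odd_tail_index \<and> fst z - 1 + sum_list (snd z) = p + 2.
      2 ^ (fst z + 1) * mzv (rev (snd z) @ [fst z + 1]))"
  proof (rule sum.reindex_bij_witness[of _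
      "\<lambda>(b, as). (length as - 1, rev as @ [b])" "\<lambda>(m, \<alpha>s). (\<alpha>s ! (m + 1), rev (take (m + 1) \<alpha>s))"])
    fix x assume "x \<in> (SIGMA m:{m. m \<le> p + 1 \<and> even m}. compositions (m + 2) (p + 3))"
    then obtain m \<alpha>s where x: "x = (m, \<alpha>s)" "m \<le> p + 1" "even m" "\<alpha>s \<in> compositions (m + 2) (p + 3)"
      by auto
    then obtain \<beta>s b where \<alpha>s: "\<alpha>s = \<beta>s @ [b]" "length \<beta>s = m + 1"
      by (cases \<alpha>s rule: rev_cases) (auto simp: compositions_def)
    show "(case case x of (m, \<alpha>s) \<Rightarrow> (\<alpha>s ! (m + 1), rev (take (m + 1) \<alpha>s)) of
            (b, as) \<Rightarrow> (length as - 1, rev as @ [b])) = x"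
      using \<alpha>s by (simp add: x nth_append)
    show "(case x of (m, \<alpha>s) \<Rightarrow> (\<alpha>s ! (m + 1), rev (take (m + 1) \<alpha>s))) \<in>
            {z. z \<in> odd_tail_index \<and> fst z - 1 + sum_list (snd z) = p + 2}"
      using \<alpha>s x(2-) by (auto simp: x(1) nth_append odd_tail_index_def compositions_def)
    show "2 ^ (fst (case x of (m, \<alpha>s) \<Rightarrow> (\<alpha>s ! (m + 1), rev (take (m + 1) \<alpha>s))) + 1) *
          mzv (rev (snd (case x of (m, \<alpha>s) \<Rightarrow> (\<alpha>s ! (m + 1), rev (take (m + 1) \<alpha>s)))) @
               [fst (case x of (m, \<alpha>s) \<Rightarrow> (\<alpha>s ! (m + 1), rev (take (m + 1) \<alpha>s))) + 1]) =
          (case x of (m, \<alpha>s) \<Rightarrow> 2 ^ (\<alpha>s ! (m + 1) + 1) * mzv (take (m + 1) \<alpha>s @ [\<alpha>s ! (m + 1) + 1]))"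
      by (simp add: x(1))
  next
    fix z assume "z \<in> {z. z \<in> odd_tail_index \<and> fst z - 1 + sum_list (snd z) = p + 2}"
    then obtain b as where z: "z = (b, as)" "b \<ge> 1" "\<forall>a\<in>set as. 1 \<le> a" "odd (length as)" "b - 1 + sum_list as = p + 2"
      by (auto simp: odd_tail_index_def)
    have pos: "length as > 0" using z by (auto elim: oddE)
    show "(case case z of (b, as) \<Rightarrow> (length as - 1, rev as @ [b]) of
            (m, \<alpha>s) \<Rightarrow> (\<alpha>s ! (m + 1), rev (take (m + 1) \<alpha>s))) = z"
      using pos by (simp add: z(1) nth_append)
    show "(case z of (b, as) \<Rightarrow> (length as - 1, rev as @ [b])) \<in>
            (SIGMA m:{m. m \<le> p + 1 \<and> even m}. compositions (m + 2) (p + 3))"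
      using pos z length_le_sum_list[OF z(3)] by (auto simp: compositions_def sum_list_rev)
  qed
  finally show ?thesis .
qed

lemma all_ones_if_sum_list_eq_length:
  fixes as :: "nat list"
  assumes "\<forall>a\<in>set as. 1 \<le> a" "sum_list as = length as"
  shows "as = replicate (length as) 1"
  using assms
proof (induction as)
  case (Cons a as)
  from Cons.prems length_le_sum_list[of as] have "a = 1" "sum_list as = length as" by auto
  with Cons show ?case by simp
qed simp

lemma compositions_same: "compositions n n = {replicate n 1}"
  using all_ones_if_sum_list_eq_length by (auto simp: compositions_def sum_list_replicate)

section \<open>Generating functions of single zeta values and of the Z-product\<close>

lemma zeta_sums:
  "(\<lambda>i. 1 / real (Suc i) ^ (n + 2)) sums mzv [n + 2]"
  using mzv_snoc_sums[of "[]" "n + 2"] by simp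

text \<open>Summability is the double telescope with \<alpha> = 0 and \<beta> = 1 - t. The
  coefficient n + 1 comes from the differentiated geometric series in t / k.\<close>

lemma shifted_square_sums:
  fixes t :: real
  assumes t: "0 < t" "t < 1"
  shows "summable (\<lambda>i. 1 / (real (Suc i) - t)\<^sup>2)"
    and "(\<lambda>n. (real n + 1) * mzv [n + 2] * t ^ n) sums (\<Sum>i. 1 / (real (Suc i) - t)\<^sup>2)"
proof -
  have "(\<lambda>n. 1 / ((1 - t + real n - 0) * (1 - t + real n))) = (\<lambda>i. 1 / (real (Suc i) - t)\<^sup>2)"
    by (simp add: fun_eq_iff power2_eq_square algebra_simps)
  thus summ: "summable (\<lambda>i. 1 / (real (Suc i) - t)\<^sup>2)"
    using pochhammer_double_telescope(2)[of 0 "1 - t"] t by (simp add: sums_iff)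
  have H: "((\<lambda>n. 1 / real (Suc i) ^ (n + 2) * ((real n + 1) * t ^ n)) has_sum (1 / (real (Suc i) - t)\<^sup>2)) UNIV" for i
  proof (rule sums_nonneg_imp_has_sum)
    define k where "k = real (Suc i)"
    have k: "k > 0" "k - t > 0" using t by (auto simp: k_def)
    have "(\<lambda>n. 1 / k\<^sup>2 * (of_nat (Suc n) * (t / k) ^ n)) sums (1 / k\<^sup>2 * (1 / (1 - t / k)\<^sup>2))"
      using k t by (intro sums_mult geometric_deriv_sums) auto
    also have "1 / k\<^sup>2 * (1 / (1 - t / k)\<^sup>2) = 1 / (k * (1 - t / k))\<^sup>2"
      by (simp add: power_mult_distrib)
    also have "k * (1 - t / k) = k - t"
      using k by (simp add: field_simps)
    finally have "(\<lambda>n. 1 / k ^ (n + 2) * ((real n + 1) * t ^ n)) sums (1 / (k - t)\<^sup>2)"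
      by (simp add: power_add power_divide power2_eq_square mult_ac add_ac)
    thus "(\<lambda>n. 1 / real (Suc i) ^ (n + 2) * ((real n + 1) * t ^ n)) sums (1 / (real (Suc i) - t)\<^sup>2)"
      by (simp only: k_def)
  qed (use t in auto)
  have "((\<lambda>n. mzv [n + 2] * ((real n + 1) * t ^ n)) has_sum (\<Sum>i. 1 / (real (Suc i) - t)\<^sup>2)) UNIV"
    by (rule has_sum_exchange_weighted[where c = "\<lambda>i n. 1 / real (Suc i) ^ (n + 2)"
          and G = "\<lambda>i. 1 / (real (Suc i) - t)\<^sup>2" and H = "\<lambda>i. 1 / (real (Suc i) - t)\<^sup>2"])
       (use H summ t zeta_sums in \<open>auto simp: abs_mult summable_sums simp del: of_nat_Suc\<close>)
  from has_sum_imp_sums[OF this] show "(\<lambda>n. (real n + 1) * mzv [n + 2] * t ^ n) sums (\<Sum>i. 1 / (real (Suc i) - t)\<^sup>2)"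
    by (simp add: mult_ac)
qed

text \<open>The mean of the geometric sums 1 / (k (k - t)) and 1 / (k (k + t)) is 1 / (k^2 - t^2),
  and averaging removes the odd powers of t.\<close>

lemma difference_of_squares_sums:
  fixes t :: real
  assumes t: "0 < t" "t < 1"
  shows "summable (\<lambda>i. 1 / ((real (Suc i))\<^sup>2 - t\<^sup>2))"
    and "(\<lambda>n. (if even n then mzv [n + 2] else 0) * t ^ n) sums (\<Sum>i. 1 / ((real (Suc i))\<^sup>2 - t\<^sup>2))"
proof -
  show summ: "summable (\<lambda>i. 1 / ((real (Suc i))\<^sup>2 - t\<^sup>2))"
  proof (rule summable_comparison_test'[OF shifted_square_sums(1)[OF t], where N = 0])
    fix i :: nat
    define k where "k = real (Suc i)"
    have k: "k - t > 0" "k > 0" using t by (auto simp: k_def)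
    have sq: "k\<^sup>2 - t\<^sup>2 = (k - t) * (k + t)" by (simp add: algebra_simps power2_eq_square)
    have "(k - t) * (k - t) \<le> (k - t) * (k + t)"
      using k t by (intro mult_left_mono) auto
    hence "1 / (k\<^sup>2 - t\<^sup>2) \<le> 1 / (k - t)\<^sup>2"
      unfolding sq power2_eq_square[of "k - t"] using k t by (intro divide_left_mono mult_pos_pos) auto
    moreover have "k\<^sup>2 - t\<^sup>2 \<ge> 0" unfolding sq using k t by auto
    ultimately show "norm (1 / ((real (Suc i))\<^sup>2 - t\<^sup>2)) \<le> 1 / (real (Suc i) - t)\<^sup>2"
      by (simp add: k_def)
  qed
  have H: "((\<lambda>n. 1 / real (Suc i) ^ (n + 2) * (if even n then t ^ n else 0)) has_sum (1 / ((real (Suc i))\<^sup>2 - t\<^sup>2))) UNIV" for i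
  proof -
    define k where "k = real (Suc i)"
    have k: "k > 0" "k - t > 0" "k + t > 0" using t by (auto simp: k_def)
    have "((\<lambda>n. 1 / 2 * (t ^ n / k ^ (n + 2) + (- t) ^ n / k ^ (n + 2))) has_sum
             (1 / 2 * (1 / (k * (k - t)) + 1 / (k * (k - - t))))) UNIV"
      using t k by (intro has_sum_cmult_right has_sum_add geometric_has_sum) auto
    also have "(\<lambda>n. 1 / 2 * (t ^ n / k ^ (n + 2) + (- t) ^ n / k ^ (n + 2))) =
               (\<lambda>n. 1 / k ^ (n + 2) * (if even n then t ^ n else 0))"
      by (auto simp: fun_eq_iff)
    also have "1 / 2 * (1 / (k * (k - t)) + 1 / (k * (k - - t))) = 1 / ((k - t) * (k + t))"
      using k by (simp add: divide_simps) (simp add: algebra_simps)?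
    also have "(k - t) * (k + t) = k\<^sup>2 - t\<^sup>2" by (simp add: algebra_simps power2_eq_square)
    finally show ?thesis by (simp only: k_def)
  qed
  have "((\<lambda>n. mzv [n + 2] * (if even n then t ^ n else 0)) has_sum (\<Sum>i. 1 / ((real (Suc i))\<^sup>2 - t\<^sup>2))) UNIV"
  proof (rule has_sum_exchange_weighted[where c = "\<lambda>i n. 1 / real (Suc i) ^ (n + 2)"
          and G = "\<lambda>i. 1 / ((real (Suc i))\<^sup>2 - t\<^sup>2)" and H = "\<lambda>i. 1 / ((real (Suc i))\<^sup>2 - t\<^sup>2)"])
    have "\<bar>if even n then t ^ n else 0\<bar> = (if even n then t ^ n else 0)" for n
      using t by simp
    thus "((\<lambda>n. 1 / real (Suc i) ^ (n + 2) * \<bar>if even n then t ^ n else 0\<bar>) has_sum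
            (1 / ((real (Suc i))\<^sup>2 - t\<^sup>2))) UNIV" for i
      using H[of i] by (simp only:)
  qed (use H summ zeta_sums in \<open>auto simp: summable_sums simp del: of_nat_Suc\<close>)
  also have "(\<lambda>n. mzv [n + 2] * (if even n then t ^ n else 0)) = (\<lambda>n. (if even n then mzv [n + 2] else 0) * t ^ n)"
    by auto
  finally show "(\<lambda>n. (if even n then mzv [n + 2] else 0) * t ^ n) sums (\<Sum>i. 1 / ((real (Suc i))\<^sup>2 - t\<^sup>2))"
    by (rule has_sum_imp_sums)
qed

lemma Z_product_sums:
  fixes t zm zp :: real
  assumes t: "0 < t" "t < 1"
    and zm: "(\<lambda>n. Z_minus n * t ^ n) sums zm" and zp: "(\<lambda>n. Z_plus n * t ^ n) sums zp"
  shows "(\<lambda>n. (if n < 2 then 0 else \<Sum>i\<le>n - 2. Z_minus i * Z_plus (n - 2 - i)) * t ^ n) sums (t\<^sup>2 * (zm * zp))"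
proof -
  \<comment> \<open>A point strictly between t and 1: convergence there gives the absolute
    convergence at t that the Cauchy product requires.\<close>
  define s where "s = (1 + t) / 2"
  have s: "0 < s" "s < 1" "norm t < norm s" using t by (auto simp: s_def)
  have "summable (\<lambda>n. norm (Z_minus n * t ^ n))"
    using powser_insidea[OF sums_summable[OF Z_minus_sums[OF s(1,2)]] s(3)] .
  moreover have "summable (\<lambda>n. norm (Z_plus n * t ^ n))"
    using powser_insidea[OF sums_summable[OF Z_plus_sums[OF s(1,2)]] s(3)] .
  ultimately have "(\<lambda>k. \<Sum>i\<le>k. Z_minus i * t ^ i * (Z_plus (k - i) * t ^ (k - i))) sums (zm * zp)"
    using Cauchy_product_sums[of "\<lambda>n. Z_minus n * t ^ n" "\<lambda>n. Z_plus n * t ^ n"] zm zp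
    by (simp add: sums_iff)
  also have "(\<lambda>k. \<Sum>i\<le>k. Z_minus i * t ^ i * (Z_plus (k - i) * t ^ (k - i))) =
             (\<lambda>k. (\<Sum>i\<le>k. Z_minus i * Z_plus (k - i)) * t ^ k)"
  proof
    fix k
    show "(\<Sum>i\<le>k. Z_minus i * t ^ i * (Z_plus (k - i) * t ^ (k - i))) = (\<Sum>i\<le>k. Z_minus i * Z_plus (k - i)) * t ^ k"
      unfolding sum_distrib_right
    proof (intro sum.cong refl)
      fix i assume "i \<in> {..k}"
      hence "t ^ k = t ^ i * t ^ (k - i)" by (simp flip: power_add)
      thus "Z_minus i * t ^ i * (Z_plus (k - i) * t ^ (k - i)) = Z_minus i * Z_plus (k - i) * t ^ k"
        by simp
    qed
  qed
  finally have "(\<lambda>k. t\<^sup>2 * ((\<Sum>i\<le>k. Z_minus i * Z_plus (k - i)) * t ^ k)) sums (t\<^sup>2 * (zm * zp))"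
    by (rule sums_mult)
  hence "(\<lambda>k. (if k + 2 < 2 then 0 else \<Sum>i\<le>k + 2 - 2. Z_minus i * Z_plus (k + 2 - 2 - i)) * t ^ (k + 2)) sums
           (t\<^sup>2 * (zm * zp))"
    by (simp add: power_add mult_ac power2_eq_square)
  thus ?thesis
    by (subst (asm) sums_iff_shift) simp
qed

section \<open>Comparison of the coefficients of t^(p + 2)\<close>

theorem theorem1p1:
  fixes p :: nat
  shows "(\<Sum>m | m \<le> p \<and> even m. \<Sum>\<alpha>s \<in> compositions (m + 2) (p + 3).
            2 ^ (\<alpha>s ! (m + 1) + 1) * mzv (take (m + 1) \<alpha>s @ [\<alpha>s ! (m + 1) + 1]))
       = (\<Sum>m = 0..p div 2. Z_minus (2 * m) * Z_plus (p - 2 * m)) + Z_plus (p + 2)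
         + (if even p then (real p + 2) * mzv [p + 4] - Z_minus (p + 2)
            else (real p - 1) * mzv [p + 4])"
proof -
  define Q where "Q n = (\<Sum>z | z \<in> odd_tail_index \<and> fst z - 1 + sum_list (snd z) = n.
      2 ^ (fst z + 1) * mzv (rev (snd z) @ [fst z + 1]))" for n
  \<comment> \<open>The coefficient of t^n in zp - zm + t^2 zm zp + s1 - s2; the factor t^2 delays
    the convolution by two places.\<close>
  define C where "C n = Z_plus n - Z_minus n +
      (if n < 2 then 0 else \<Sum>i\<le>n - 2. Z_minus i * Z_plus (n - 2 - i)) +
      (real n + 1) * mzv [n + 2] - (if even n then mzv [n + 2] else 0)" for n
  define zm zp s1 s2 F :: "real \<Rightarrow> real" where
    "zm t = (\<Sum>i. pochhammer (1 + t) i / fact i / (real (Suc i) * (real (Suc i) + t)))" and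
    "zp t = (\<Sum>i. pochhammer (1 + t) i / fact i / (real (Suc i) * (real (Suc i) - t)))" and
    "s1 t = (\<Sum>i. 1 / (real (Suc i) - t)\<^sup>2)" and "s2 t = (\<Sum>i. 1 / ((real (Suc i))\<^sup>2 - t\<^sup>2))" and
    "F t = zp t - zm t + t\<^sup>2 * (zm t * zp t) + s1 t - s2 t" for t
  have Q: "(\<lambda>n. Q n * t ^ n) sums F t" if t: "0 < t" "t < 1 / 2" for t
  proof -
    have "(\<lambda>i. pochhammer (1 + t) i / fact i / (real (Suc i) * (real (Suc i) - t))) sums zp t"
      unfolding zp_def using t by (intro summable_sums gauss_series_summable) auto
    moreover have "(\<lambda>i. pochhammer (1 + t) i / fact i / (real (Suc i) * (real (Suc i) + t))) sums zm t"
      unfolding zm_def using t summable_sums[OF gauss_series_summable[of t "- t"]] by simp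
    moreover have "(\<lambda>i. 1 / (real (Suc i) - t)\<^sup>2) sums s1 t"
      unfolding s1_def using t by (intro summable_sums shifted_square_sums) auto
    moreover have "(\<lambda>i. 1 / ((real (Suc i))\<^sup>2 - t\<^sup>2)) sums s2 t"
      unfolding s2_def using t by (intro summable_sums difference_of_squares_sums) auto
    ultimately have "((\<lambda>(b, as). 2 ^ (b + 1) * mzv (rev as @ [b + 1]) * t ^ (b - 1 + sum_list as)) has_sum F t) odd_tail_index"
      unfolding F_def by (intro odd_tail_mzv_has_sum[OF t] generating_function_identity[OF t])
    hence "((\<lambda>z. 2 ^ (fst z + 1) * mzv (rev (snd z) @ [fst z + 1]) * t ^ (fst z - 1 + sum_list (snd z))) has_sum F t) odd_tail_index"
      by (simp only: case_prod_unfold)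
    from has_sum_graded_imp_sums[OF this finite_odd_tail_index] show ?thesis
      unfolding Q_def .
  qed
  have C: "(\<lambda>n. C n * t ^ n) sums F t" if t: "0 < t" "t < 1 / 2" for t
  proof -
    have t': "0 < t" "t < 1" using t by auto
    have "(\<lambda>n. Z_plus n * t ^ n - Z_minus n * t ^ n +
             (if n < 2 then 0 else \<Sum>i\<le>n - 2. Z_minus i * Z_plus (n - 2 - i)) * t ^ n +
             (real n + 1) * mzv [n + 2] * t ^ n - (if even n then mzv [n + 2] else 0) * t ^ n) sums F t"
      unfolding F_def zp_def zm_def s1_def s2_def
      by (intro sums_add sums_diff Z_plus_sums Z_minus_sums Z_product_sums shifted_square_sums(2)
                difference_of_squares_sums(2) t')
    thus ?thesis
      unfolding C_def left_diff_distrib distrib_right .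
  qed
  have "Q (p + 2) = C (p + 2)"
    by (rule power_series_unique[where \<epsilon> = "1 / 2" and f = F]) (use Q C in auto)
  moreover have "C (p + 2) = (\<Sum>m = 0..p div 2. Z_minus (2 * m) * Z_plus (p - 2 * m)) + Z_plus (p + 2)
      - Z_minus (p + 2) + (real p + 3) * mzv [p + 4] - (if even p then mzv [p + 4] else 0)"
  proof -
    \<comment> \<open>Only even i survive, by duality; this is why the theorem has
      \<open>2 * m\<close> as argument of \<open>Z_minus\<close>.\<close>
    have "(\<Sum>i\<le>p. Z_minus i * Z_plus (p - i)) = (\<Sum>i | i \<le> p \<and> even i. Z_minus i * Z_plus (p - i))"
      by (rule sum.mono_neutral_right) (auto simp: Z_minus_odd)
    also have "\<dots> = (\<Sum>m = 0..p div 2. Z_minus (2 * m) * Z_plus (p - 2 * m))"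
      by (rule sum.reindex_bij_witness[of _ "\<lambda>m. 2 * m" "\<lambda>i. i div 2"]) auto
    finally have sum: "(\<Sum>i\<le>p. Z_minus i * Z_plus (p - i)) = (\<Sum>m = 0..p div 2. Z_minus (2 * m) * Z_plus (p - 2 * m))" .
    have "p + 2 + 2 = p + 4" by simp
    thus ?thesis
      unfolding C_def by (simp only:) (simp add: sum)
  qed
  \<comment> \<open>For odd p the power series also contains m = p + 1, whose only composition is (1, ..., 1);
    by duality it contributes 4 * mzv [p + 4].\<close>
  moreover have "Q (p + 2) = (\<Sum>m | m \<le> p \<and> even m. \<Sum>\<alpha>s \<in> compositions (m + 2) (p + 3).
            2 ^ (\<alpha>s ! (m + 1) + 1) * mzv (take (m + 1) \<alpha>s @ [\<alpha>s ! (m + 1) + 1])) +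
            (if even p then 0 else 4 * mzv [p + 4])"
  proof -
    let ?g = "\<lambda>m. \<Sum>\<alpha>s \<in> compositions (m + 2) (p + 3).
            2 ^ (\<alpha>s ! (m + 1) + 1) * mzv (take (m + 1) \<alpha>s @ [\<alpha>s ! (m + 1) + 1])"
    have "Q (p + 2) = (\<Sum>m | m \<le> p + 1 \<and> even m. ?g m)"
      unfolding Q_def sum_compositions_eq ..
    also have "\<dots> = (\<Sum>m | m \<le> p \<and> even m. ?g m) + (if even p then 0 else ?g (p + 1))"
    proof (cases "even p")
      case True
      hence "{m. m \<le> p + 1 \<and> even m} = {m. m \<le> p \<and> even m}" by (auto simp: le_Suc_eq)
      with True show ?thesis by simp
    next
      case False
      hence "{m. m \<le> p + 1 \<and> even m} = insert (p + 1) {m. m \<le> p \<and> even m}" by (auto simp: le_Suc_eq)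
      with False show ?thesis by simp
    qed
    also have "?g (p + 1) = 4 * mzv [p + 4]"
    proof -
      have "p + 1 + 2 = p + 3" by simp
      hence comp: "compositions (p + 1 + 2) (p + 3) = {replicate (p + 3) 1}"
        by (simp only: compositions_same)
      have nth: "replicate (p + 3) (1 :: nat) ! (p + 1 + 1) = 1"
        by (rule nth_replicate) simp
      have take: "take (p + 1 + 1) (replicate (p + 3) (1 :: nat)) = replicate (p + 2) 1"
        unfolding take_replicate by (simp add: min_def)
      have sing: "sum f {x} = f x" for f :: "nat list \<Rightarrow> real" and x
        by simp
      \<comment> \<open>The last part is 1, so the power of two is 2^(1 + 1) = 4. Writing the last
        exponent as \<open>0 + 2\<close> lets duality apply with b = 0, where the ones on the other
        side disappear.\<close>
      have "?g (p + 1) = 4 * mzv (replicate (p + 2) 1 @ [0 + 2])"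
        unfolding comp sing nth take one_add_one add_0 by simp
      moreover have "p + 2 + 2 = p + 4" by simp
      ultimately show ?thesis
        by (simp only: mzv_ones_duality[of "p + 2" 0] replicate_0 append_Nil)
    qed
    finally show ?thesis .
  qed
  \<comment> \<open>The multiple of \<open>mzv [p + 4]\<close> starts as p + 3. For even p it loses
    1 from s2 and becomes p + 2; for odd p it loses the 4 of the additional term and becomes p - 1,
    while \<open>Z_minus (p + 2)\<close> vanishes.\<close>
  ultimately show ?thesis
    by (cases "even p") (auto simp: Z_minus_odd algebra_simps)
qed

end
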